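(* Let $G$ be a countable amenable residually finite group and let $\mathscr A$ be a finite set. Then for every number $h\in[0,\log|\mathscr A|)$ there exists a Toeplitz configuration $\eta\in\mathscr A^G$ such that $h(\eta)=h$, where $h(\eta)=h_{\mathrm{top}}(\overline{G\eta},G)$.
   Context: $G$ acts on $\mathscr A^G$ ($\mathscr A$ discrete, product topology) by the shift $(\gamma,(x_g)_{g\in G})\mapsto(x_{g\gamma})_{g\in G}$; $\overline{G\eta}$ is the closure of the orbit of $\eta$. A countable group is residually finite if it has a nested sequence of finite index normal subgroups with trivial intersection. $\underline x\in\mathscr A^G$ is a Toeplitz configuration if for every $g\in G$ there is a finite index subgroup $H$ of $G$ such that $\underline x(\gamma g)=\underline x(g)$ for all $\gamma\in H$. A (left) Følner sequence is a sequence $\{F_n\}$ of non-empty finite subsets of $G$ with $|gF_n\triangle F_n|/|F_n|\to0$ for every $g\in G$; $G$ is amenable if it admits one. Topological entropy: for a dynamical system $(Y,G)$ (a continuous action of $G$ on a compact metric space $Y$) and an open cover $\mathcal U$ of $Y$, let $\mathcal N(\mathcal U)$ be the minimal cardinality of a subcover, and for finite non-empty $F\subset G$ let $\mathcal U^F=\bigvee_{f\in F}f^{-1}\mathcal U$ (common refinement, where $\mathcal U\vee\mathcal V=\{U\cap V: U\in\mathcal U, V\in\mathcal V\}$). Then $h(Y,G,\mathcal U)=\lim_n\log\mathcal N(\mathcal U^{F_n})/|F_n|$ (the limit exists and is independent of the Følner sequence) and $h_{\mathrm{top}}(Y,G)=\sup_{\mathcal U}h(Y,G,\mathcal U)$,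 the supremum over all open covers of $Y$.
   Formalization: The group G is additionally assumed to be infinite; for a finite group and at least two symbols the claim fails, since the orbit closure is a finite set and its entropy can only be log k / |G| for an integer k. *)

theory Defs
  imports "HOL-Analysis.Analysis" "HOL-Algebra.Coset"
begin

definition residually_finite :: "('g, 'm) monoid_scheme \<Rightarrow> bool" where
  "residually_finite G \<longleftrightarrow>
     (\<exists>H :: nat \<Rightarrow> 'g set.
        (\<forall>n. H n \<lhd> G \<and> finite (rcosets\<^bsub>G\<^esub> (H n)) \<and> H (Suc n) \<subseteq> H n) \<and>
        (\<Inter>n. H n) = {\<one>\<^bsub>G\<^esub>})"

definition folner_sequence :: "('g, 'm) monoid_scheme \<Rightarrow> (nat \<Rightarrow> 'g set) \<Rightarrow> bool" where
  "folner_sequence G F \<longleftrightarrow>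
     (\<forall>n. finite (F n) \<and> F n \<noteq> {} \<and> F n \<subseteq> carrier G) \<and>
     (\<forall>g\<in>carrier G.
        (\<lambda>n. real (card (sym_diff (g <#\<^bsub>G\<^esub> F n) (F n))) / real (card (F n))) \<longlonglongrightarrow> 0)"

definition amenable :: "('g, 'm) monoid_scheme \<Rightarrow> bool" where
  "amenable G \<longleftrightarrow> (\<exists>F. folner_sequence G F)"

definition open_cover :: "'y topology \<Rightarrow> 'y set set \<Rightarrow> bool" where
  "open_cover Y \<U> \<longleftrightarrow> (\<forall>U\<in>\<U>. openin Y U) \<and> \<Union>\<U> = topspace Y"

text \<open>Only finite subcovers compete, since \<^const>\<open>card\<close> is 0 on infinite sets;
  in a compact space an open cover always has one.\<close>

definition subcover_number :: "'y topology \<Rightarrow> 'y set set \<Rightarrow> nat" where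
  "subcover_number Y \<U> =
     (LEAST n. \<exists>\<V>. \<V> \<subseteq> \<U> \<and> finite \<V> \<and> \<Union>\<V> = topspace Y \<and> card \<V> = n)"

text \<open>The common refinement of the covers \<open>f\<inverse> \<U>\<close>, \<open>f \<in> F\<close>: a member is an intersection, over
  \<open>f \<in> F\<close>, of preimages under \<open>f\<close> of members \<open>W f\<close> of \<open>\<U>\<close>.\<close>

definition refined_cover ::
    "'y topology \<Rightarrow> ('g \<Rightarrow> 'y \<Rightarrow> 'y) \<Rightarrow> 'y set set \<Rightarrow> 'g set \<Rightarrow> 'y set set" where
  "refined_cover Y act \<U> F =
     {{y \<in> topspace Y. \<forall>f\<in>F. act f y \<in> W f} | W. W \<in> F \<rightarrow> \<U>}"

text \<open>For a continuous action on a compact space the limit exists and is the same along all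
  Folner sequences (Ornstein--Weiss); only then is the description proper.\<close>

definition cover_entropy ::
    "('g, 'm) monoid_scheme \<Rightarrow> 'y topology \<Rightarrow> ('g \<Rightarrow> 'y \<Rightarrow> 'y) \<Rightarrow> 'y set set \<Rightarrow> real" where
  "cover_entropy G Y act \<U> =
     (THE L. \<forall>F. folner_sequence G F \<longrightarrow>
        (\<lambda>n. ln (real (subcover_number Y (refined_cover Y act \<U> (F n)))) / real (card (F n)))
          \<longlonglongrightarrow> L)"

definition topological_entropy ::
    "('g, 'm) monoid_scheme \<Rightarrow> 'y topology \<Rightarrow> ('g \<Rightarrow> 'y \<Rightarrow> 'y) \<Rightarrow> ereal" where
  "topological_entropy G Y act = (SUP \<U> \<in> {\<U>. open_cover Y \<U>}. ereal (cover_entropy G Y act \<U>))"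

definition configurations :: "('g, 'm) monoid_scheme \<Rightarrow> 'a set \<Rightarrow> ('g \<Rightarrow> 'a) set" where
  "configurations G A = carrier G \<rightarrow>\<^sub>E A"

definition configuration_topology ::
    "('g, 'm) monoid_scheme \<Rightarrow> 'a set \<Rightarrow> ('g \<Rightarrow> 'a) topology" where
  "configuration_topology G A = product_topology (\<lambda>_. discrete_topology A) (carrier G)"

definition shift :: "('g, 'm) monoid_scheme \<Rightarrow> 'g \<Rightarrow> ('g \<Rightarrow> 'a) \<Rightarrow> ('g \<Rightarrow> 'a)" where
  "shift G \<gamma> x = (\<lambda>g\<in>carrier G. x (g \<otimes>\<^bsub>G\<^esub> \<gamma>))"

definition orbit_closure ::
    "('g, 'm) monoid_scheme \<Rightarrow> 'a set \<Rightarrow> ('g \<Rightarrow> 'a) \<Rightarrow> ('g \<Rightarrow> 'a) set" where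
  "orbit_closure G A \<eta> =
     configuration_topology G A closure_of ((\<lambda>\<gamma>. shift G \<gamma> \<eta>) ` carrier G)"

definition toeplitz :: "('g, 'm) monoid_scheme \<Rightarrow> 'a set \<Rightarrow> ('g \<Rightarrow> 'a) \<Rightarrow> bool" where
  "toeplitz G A x \<longleftrightarrow>
     x \<in> configurations G A \<and>
     (\<forall>g\<in>carrier G. \<exists>H. subgroup H G \<and> finite (rcosets\<^bsub>G\<^esub> H) \<and>
        (\<forall>\<gamma>\<in>H. x (\<gamma> \<otimes>\<^bsub>G\<^esub> g) = x g))"

definition configuration_entropy ::
    "('g, 'm) monoid_scheme \<Rightarrow> 'a set \<Rightarrow> ('g \<Rightarrow> 'a) \<Rightarrow> ereal" where
  "configuration_entropy G A \<eta> =
     topological_entropy G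
       (subtopology (configuration_topology G A) (orbit_closure G A \<eta>)) (shift G)"

end

theory Submission
  imports Defs
begin

text \<open>Put \<open>d = h / ln |A|\<close>, a number in \<open>[0, 1)\<close>. The configuration is written in stages.
  After each stage it is decided outside a set of holes, which is a union of cosets of a finite index
  normal subgroup \<open>H\<close> and has density slightly above \<open>d\<close>; on the decided positions it is \<open>H\<close>-periodic,
  which is what makes the final configuration Toeplitz. One stage takes a Folner set \<open>F\<close>, so large
  that about the right proportion of it consists of holes, and writes every possible filling of the
  holes of \<open>F\<close> at some translate of \<open>F\<close> by an element of \<open>H\<close>. The finitely many positions needed
  for this become a negligible proportion of \<open>G\<close> when they are repeated periodically along a deep
  enough subgroup, so that enough holes are left, and filling more of them with an arbitrary symbol
  brings the density down towards \<open>d\<close> (\<open>partial_toeplitz_extend\<close>, \<open>toeplitz_with_hole_density\<close>).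

  The patterns seen in a Folner set \<open>F\<close> used by one of the stages number at least
  \<open>|A| ^ (d |F|)\<close>, by the fillings that were written. In no Folner sequence do they grow
  exponentially faster than this, because, at any stage, a pattern is determined by the residue class of its
  position modulo \<open>H\<close> and by its symbols on the holes, and every translate of \<open>F\<close> meets the holes in
  nearly their density (\<open>folner_density\<close>, \<open>pattern_growth_le\<close>).

  The entropy of the cover of the orbit closure by the symbol at the identity counts exactly these
  patterns (\<open>patterns_le_symbol_cover\<close>), and by compactness any other open cover is coarser
  than the partition by the symbols in a finite window (\<open>open_cover_window\<close>). Moving the window
  over \<open>F\<close> uncovers only a negligible number of positions outside \<open>F\<close>, so that the growth rate of
  patterns bounds the entropy of every open cover. Since the entropy of a cover is by definition
  the common limit along all Folner sequences, these estimates say something only once that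
  limit is known to exist. This is the Ornstein--Weiss lemma (\<open>ornstein_weiss\<close>): a subadditive,
  right-invariant function whose average on some Folner sequence is at most \<open>a\<close> has average at most
  \<open>a + e\<close> on every sufficiently invariant set, because such a set is, up to a small remainder, almost
  disjointly packed by right translates of members of that sequence.\<close>

section \<open>Folner sequences and boundaries\<close>

definition inner_boundary :: "('g, 'm) monoid_scheme \<Rightarrow> 'g set \<Rightarrow> 'g set \<Rightarrow> 'g set" where
  "inner_boundary G K S = {c \<in> S. \<exists>k\<in>K. k \<otimes>\<^bsub>G\<^esub> c \<notin> S}"

lemma (in group) left_cancel:
  assumes "x \<in> carrier G" "y \<in> carrier G" "z \<in> carrier G"
  shows "x \<otimes> y = x \<otimes> z \<longleftrightarrow> y = z"
  using assms by (simp add: Units_eq)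

lemma (in group) card_r_coset:
  assumes "E \<subseteq> carrier G" "c \<in> carrier G"
  shows "card (E #> c) = card E"
proof -
  have "E #> c = (\<lambda>e. e \<otimes> c) ` E" by (auto simp: r_coset_def)
  moreover have "inj_on (\<lambda>e. e \<otimes> c) E" 
    using assms by (intro inj_onI) (metis right_cancel subsetD)
  ultimately show ?thesis by (simp add: card_image)
qed

lemma (in group) card_l_coset:
  assumes "E \<subseteq> carrier G" "c \<in> carrier G"
  shows "card (c <# E) = card E"
proof -
  have "c <# E = (\<lambda>e. c \<otimes> e) ` E" by (auto simp: l_coset_def)
  moreover have "inj_on (\<lambda>e. c \<otimes> e) E" 
    using assms by (intro inj_onI) (metis left_cancel subsetD)
  ultimately show ?thesis by (simp add: card_image)
qed

lemma finite_r_coset: "finite E \<Longrightarrow> finite (E #>\<^bsub>G\<^esub> c)"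
  by (auto simp: r_coset_def)

lemma finite_l_coset: "finite E \<Longrightarrow> finite (c <#\<^bsub>G\<^esub> E)"
  by (auto simp: l_coset_def)

lemma folner_sequenceD:
  assumes "folner_sequence G F"
  shows "finite (F n)" "F n \<noteq> {}" "F n \<subseteq> carrier G" "0 < card (F n)"
  using assms by (auto simp: folner_sequence_def card_gt_0_iff)

lemma folner_sequence_subseq:
  assumes "folner_sequence G F" "strict_mono r"
  shows "folner_sequence G (\<lambda>n. F (r n))"
proof -
  have "(\<lambda>n. real (card (sym_diff (g <#\<^bsub>G\<^esub> F (r n)) (F (r n)))) / real (card (F (r n)))) \<longlonglongrightarrow> 0"
    if "g \<in> carrier G" for g
    using LIMSEQ_subseq_LIMSEQ[OF _ assms(2), of "\<lambda>n. real (card (sym_diff (g <#\<^bsub>G\<^esub> F n) (F n))) / real (card (F n))" 0]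
      assms(1) that by (simp add: folner_sequence_def o_def)
  with assms(1) show ?thesis by (simp add: folner_sequence_def)
qed

text \<open>The Folner property is stated for left translations of single elements; finitely many of them
  are controlled at once by a union bound. Seen from outside, the Folner sets hardly grow
  (\<open>folner_expansion\<close>); seen from inside, few of their elements can be pushed out
  (\<open>folner_inner_boundary\<close>).\<close>

lemma (in group) folner_expansion:
  assumes F: "folner_sequence G F" and K: "finite K" "K \<subseteq> carrier G"
  shows "(\<lambda>n. real (card ((\<Union>k\<in>K. k <# F n) - F n)) / real (card (F n))) \<longlonglongrightarrow> 0"
proof (rule tendsto_sandwich[where f = "\<lambda>_. 0"])
  show "(\<lambda>n. \<Sum>k\<in>K. real (card (sym_diff (k <# F n) (F n))) / real (card (F n))) \<longlonglongrightarrow> 0"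
    using F K by (intro tendsto_null_sum) (auto simp: folner_sequence_def)
  show "\<forall>\<^sub>F n in sequentially. real (card ((\<Union>k\<in>K. k <# F n) - F n)) / real (card (F n))
      \<le> (\<Sum>k\<in>K. real (card (sym_diff (k <# F n) (F n))) / real (card (F n)))"
  proof (rule always_eventually, rule allI)
    fix n
    note fin = folner_sequenceD[OF F, of n]
    have "card ((\<Union>k\<in>K. k <# F n) - F n) \<le> card (\<Union>k\<in>K. sym_diff (k <# F n) (F n))"
      by (rule card_mono) (use K fin in \<open>auto simp: finite_l_coset\<close>)
    also have "\<dots> \<le> (\<Sum>k\<in>K. card (sym_diff (k <# F n) (F n)))"
      by (rule card_UN_le[OF K(1)])
    finally have "real (card ((\<Union>k\<in>K. k <# F n) - F n)) \<le> (\<Sum>k\<in>K. real (card (sym_diff (k <# F n) (F n))))"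
      unfolding of_nat_sum[symmetric] of_nat_le_iff .
    then show "real (card ((\<Union>k\<in>K. k <# F n) - F n)) / real (card (F n))
      \<le> (\<Sum>k\<in>K. real (card (sym_diff (k <# F n) (F n))) / real (card (F n)))"
      by (simp add: sum_divide_distrib[symmetric] divide_right_mono)
  qed
qed auto

lemma (in group) folner_inner_boundary:
  assumes F: "folner_sequence G F" and K: "finite K" "K \<subseteq> carrier G"
  shows "(\<lambda>n. real (card (inner_boundary G K (F n))) / real (card (F n))) \<longlonglongrightarrow> 0"
proof (rule tendsto_sandwich[where f = "\<lambda>_. 0"])
  show "(\<lambda>n. \<Sum>k\<in>K. real (card (sym_diff (k <# F n) (F n))) / real (card (F n))) \<longlonglongrightarrow> 0"
    using F K by (intro tendsto_null_sum) (auto simp: folner_sequence_def)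
  show "\<forall>\<^sub>F n in sequentially. real (card (inner_boundary G K (F n))) / real (card (F n))
      \<le> (\<Sum>k\<in>K. real (card (sym_diff (k <# F n) (F n))) / real (card (F n)))"
  proof (rule always_eventually, rule allI)
    fix n
    note fin = folner_sequenceD[OF F, of n]
    have one: "card {c \<in> F n. k \<otimes> c \<notin> F n} \<le> card (sym_diff (k <# F n) (F n))" if "k \<in> K" for k
    proof (rule card_inj_on_le)
      show "inj_on (\<lambda>c. k \<otimes> c) {c \<in> F n. k \<otimes> c \<notin> F n}"
        using that K fin by (intro inj_onI) (metis (mono_tags, lifting) left_cancel mem_Collect_eq subsetD)
    qed (use fin in \<open>auto simp: l_coset_def\<close>)
    have "card (inner_boundary G K (F n)) \<le> card (\<Union>k\<in>K. {c \<in> F n. k \<otimes> c \<notin> F n})"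
      by (rule card_mono) (use K fin in \<open>auto simp: inner_boundary_def\<close>)
    also have "\<dots> \<le> (\<Sum>k\<in>K. card {c \<in> F n. k \<otimes> c \<notin> F n})"
      by (rule card_UN_le[OF K(1)])
    also have "\<dots> \<le> (\<Sum>k\<in>K. card (sym_diff (k <# F n) (F n)))"
      using one by (rule sum_mono)
    finally have "real (card (inner_boundary G K (F n))) \<le> (\<Sum>k\<in>K. real (card (sym_diff (k <# F n) (F n))))"
      unfolding of_nat_sum[symmetric] of_nat_le_iff .
    then show "real (card (inner_boundary G K (F n))) / real (card (F n))
      \<le> (\<Sum>k\<in>K. real (card (sym_diff (k <# F n) (F n))) / real (card (F n)))"
      by (simp add: sum_divide_distrib[symmetric] divide_right_mono)
  qed
qed auto

section \<open>Packing a set by translates of one shape\<close>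

text \<open>A family of translates of \<open>E\<close> inside \<open>S\<close> that overlap little: the third claim says that the
  overlaps waste at most the proportion \<open>\<epsilon>\<close>. If the family is maximal, then its union has at least \<open>\<epsilon>\<close>
  times as many elements as there are admissible translation parameters: by maximality every admissible translate has at least
  the proportion \<open>\<epsilon>\<close> of its elements in the union, and an element of the union lies in at most \<open>|E|\<close>
  translates, so that counting incidences gives the bound.\<close>

lemma (in group) greedy_packing:
  fixes \<epsilon> :: real
  assumes S: "finite S" "S \<subseteq> carrier G" and E: "finite E" "E \<noteq> {}" "E \<subseteq> carrier G"
    and \<epsilon>: "0 < \<epsilon>" "\<epsilon> < 1"
  obtains C where "C \<subseteq> S" "(\<Union>c\<in>C. E #> c) \<subseteq> S"
    "(1 - \<epsilon>) * card E * card C \<le> card (\<Union>c\<in>C. E #> c)"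
    "\<epsilon> * card (S - inner_boundary G E S) \<le> card (\<Union>c\<in>C. E #> c)"
proof -
  define U where "U C = (\<Union>c\<in>C. E #> c)" for C
  define good where "good = {C. C \<subseteq> S \<and> U C \<subseteq> S \<and> (1 - \<epsilon>) * card E * card C \<le> card (U C)}"
  have "finite good"
    by (rule finite_subset[of _ "Pow S"]) (use S in \<open>auto simp: good_def\<close>)
  moreover have "{} \<in> good" by (auto simp: good_def U_def)
  ultimately obtain C where C: "C \<in> good" and max: "\<And>D. D \<in> good \<Longrightarrow> C \<subseteq> D \<Longrightarrow> C = D"
    using finite_has_maximal[of good] by (metis empty_iff)
  have CS: "C \<subseteq> S" "U C \<subseteq> S" "(1 - \<epsilon>) * card E * card C \<le> card (U C)" 
    using C by (auto simp: good_def)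
  have finC: "finite C" and finU: "finite (U C)" 
    by (rule finite_subset[OF CS(1) S(1)], rule finite_subset[OF CS(2) S(1)])
  define B where "B = S - inner_boundary G E S"
  have finB: "finite B" using S by (simp add: B_def)
  have overlap: "\<epsilon> * card E \<le> card ((E #> c) \<inter> U C)" if c: "c \<in> B" for c
  proof -
    have cS: "c \<in> S" "E #> c \<subseteq> S" using c by (auto simp: B_def inner_boundary_def r_coset_def)
    have cG: "c \<in> carrier G" using cS S by auto
    have cardE: "card (E #> c) = card E" using card_r_coset E cG by auto
    have finEc: "finite (E #> c)" using E by (simp add: finite_r_coset)
    show ?thesis
    proof (cases "c \<in> C")
      case True
      then have "(E #> c) \<inter> U C = E #> c" by (auto simp: U_def)
      then show ?thesis using cardE \<epsilon> mult_right_mono[of \<epsilon> 1 "real (card E)"] by simp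
    next
      case False
      have U': "U (insert c C) = U C \<union> ((E #> c) - U C)" by (auto simp: U_def)
      have "insert c C \<notin> good" using max[of "insert c C"] False by (metis insertI1 subset_insertI)
      moreover have "insert c C \<subseteq> S" "U (insert c C) \<subseteq> S"
        using cS CS by (simp_all add: U' le_supI2 Diff_subset_conv)
      ultimately have "card (U (insert c C)) < (1 - \<epsilon>) * card E * card (insert c C)"
        by (auto simp: good_def)
      moreover have "card (U (insert c C)) = card (U C) + card ((E #> c) - U C)"
        unfolding U' by (rule card_Un_disjoint) (use finU finEc in auto)
      moreover have "card (insert c C) = Suc (card C)" using False finC by simp
      ultimately have "card ((E #> c) - U C) < (1 - \<epsilon>) * card E"
        using CS(3) by (simp add: algebra_simps)
      moreover have "card ((E #> c) - U C) + card ((E #> c) \<inter> U C) = card E"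
        using card_Int_Diff[OF finEc, of "U C"] cardE by simp
      ultimately show ?thesis by (simp add: algebra_simps flip: of_nat_add)
    qed
  qed
  \<comment> \<open>Double counting of the pairs of a translate and an element of the union lying in it.\<close>
  have "\<epsilon> * card E * card B = (\<Sum>c\<in>B. \<epsilon> * card E)" by simp
  also have "\<dots> \<le> (\<Sum>c\<in>B. real (card ((E #> c) \<inter> U C)))"
    using overlap by (rule sum_mono)
  also have "\<dots> = real (card (SIGMA c:B. {e\<in>E. e \<otimes> c \<in> U C}))"
  proof -
    have "card ((E #> c) \<inter> U C) = card {e\<in>E. e \<otimes> c \<in> U C}" if "c \<in> B" for c
    proof -
      have cG: "c \<in> carrier G" using that S by (auto simp: B_def)
      have "(E #> c) \<inter> U C = {e\<in>E. e \<otimes> c \<in> U C} #> c" by (auto simp: r_coset_def)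
      then show ?thesis using card_r_coset[of "{e\<in>E. e \<otimes> c \<in> U C}" c] E cG by auto
    qed
    then show ?thesis using finB E by (simp add: card_SigmaI)
  qed
  also have "\<dots> \<le> real (card (E \<times> U C))"
  proof -
    have "inj_on (\<lambda>(c,e). (e, e \<otimes> c)) (SIGMA c:B. {e\<in>E. e \<otimes> c \<in> U C})"
    proof (rule inj_onI, clarsimp)
      fix c d e assume "c \<in> B" "d \<in> B" "e \<in> E" "e \<otimes> c = e \<otimes> d"
      moreover have "B \<subseteq> carrier G" using S by (auto simp: B_def)
      ultimately show "c = d" using E(3) left_cancel by (metis subsetD)
    qed
    then have "card (SIGMA c:B. {e\<in>E. e \<otimes> c \<in> U C}) \<le> card (E \<times> U C)"
      by (rule card_inj_on_le) (use E finU in auto)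
    then show ?thesis by simp
  qed
  also have "\<dots> = card E * real (card (U C))" by (simp add: card_cartesian_product)
  finally have "card E * (\<epsilon> * card B) \<le> card E * real (card (U C))" by (simp add: algebra_simps)
  moreover have "0 < real (card E)" using E by (simp add: card_gt_0_iff)
  ultimately have "\<epsilon> * card B \<le> card (U C)" by (simp only: mult_le_cancel_left_pos)
  with CS that[of C] show thesis by (simp add: U_def B_def)
qed

text \<open>Removing a packing from \<open>S\<close> creates new boundary only next to the removed translates, and the
  outer boundary of \<open>E c\<close> is the translate by \<open>c\<close> of that of \<open>E\<close>. So if \<open>E\<close> is much more invariant than
  required, the remainder of \<open>S\<close> is still invariant and can be packed again.\<close>

lemma (in group) inner_boundary_Diff_packing:
  assumes S: "finite S" "S \<subseteq> carrier G" and E: "finite E" "E \<subseteq> carrier G"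
    and K: "finite K" "K \<subseteq> carrier G" and C: "C \<subseteq> S"
  shows "card (inner_boundary G K (S - (\<Union>c\<in>C. E #> c)))
    \<le> card (inner_boundary G K S) + card C * card ((\<Union>k\<in>m_inv G ` K. k <# E) - E)"
proof -
  define D where "D = (\<Union>k\<in>m_inv G ` K. k <# E) - E"
  have finD: "finite D" using K E by (simp add: D_def finite_l_coset)
  have DG: "D \<subseteq> carrier G" using K E by (auto simp: D_def l_coset_def)
  have finC: "finite C" using C S(1) by (rule finite_subset)
  have "inner_boundary G K (S - (\<Union>c\<in>C. E #> c)) \<subseteq> inner_boundary G K S \<union> (\<Union>c\<in>C. D #> c)"
  proof
    fix s assume "s \<in> inner_boundary G K (S - (\<Union>c\<in>C. E #> c))"
    then obtain k where s: "s \<in> S" "\<And>c. c \<in> C \<Longrightarrow> s \<notin> E #> c" and k: "k \<in> K" 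
        and ks: "k \<otimes> s \<notin> S \<or> (\<exists>c\<in>C. k \<otimes> s \<in> E #> c)"
      by (auto simp: inner_boundary_def)
    have G: "s \<in> carrier G" "k \<in> carrier G" using s S k K by auto
    show "s \<in> inner_boundary G K S \<union> (\<Union>c\<in>C. D #> c)"
    proof (cases "k \<otimes> s \<in> S")
      case False
      then show ?thesis using s k by (auto simp: inner_boundary_def)
    next
      case True
      with ks obtain c e where c: "c \<in> C" "e \<in> E" "k \<otimes> s = e \<otimes> c" by (auto simp: r_coset_def)
      have G': "c \<in> carrier G" "e \<in> carrier G" using c C S E by auto
      have s_eq: "s = (inv k \<otimes> e) \<otimes> c"
        using c(3) G G' by (metis inv_closed inv_solve_left m_assoc m_closed)
      moreover have "inv k \<otimes> e \<in> D"
      proof -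
        have "inv k \<otimes> e \<notin> E" using s(2)[OF c(1)] s_eq by (auto simp: r_coset_def)
        then show ?thesis using k c by (auto simp: D_def l_coset_def)
      qed
      ultimately show ?thesis using c(1) by (auto simp: r_coset_def)
    qed
  qed
  then have "card (inner_boundary G K (S - (\<Union>c\<in>C. E #> c))) \<le> card (inner_boundary G K S \<union> (\<Union>c\<in>C. D #> c))"
    by (rule card_mono[rotated]) (use S finC finD in \<open>auto simp: inner_boundary_def finite_r_coset\<close>)
  also have "\<dots> \<le> card (inner_boundary G K S) + card (\<Union>c\<in>C. D #> c)"
    by (rule card_Un_le)
  also have "card (\<Union>c\<in>C. D #> c) \<le> (\<Sum>c\<in>C. card (D #> c))"
    by (rule card_UN_le[OF finC])
  also have "\<dots> = (\<Sum>c\<in>C. card D)"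
    by (rule sum.cong) (use card_r_coset[OF DG] C S in auto)
  finally show ?thesis by (simp add: D_def)
qed

section \<open>Limits of subadditive set functions\<close>

text \<open>The bound holds on all sets that are sufficiently invariant; how much invariance is needed is left
  open, since it grows with each step of the iteration below.\<close>

definition bounded_on_almost_invariant :: "('g, 'm) monoid_scheme \<Rightarrow> ('g set \<Rightarrow> real) \<Rightarrow> real \<Rightarrow> bool" where
  "bounded_on_almost_invariant G \<phi> b \<longleftrightarrow>
     (\<exists>K. \<exists>\<delta>::real. finite K \<and> K \<subseteq> carrier G \<and> 0 < \<delta> \<and>
        (\<forall>S. finite S \<and> S \<subseteq> carrier G \<and> real (card (inner_boundary G K S)) \<le> \<delta> * real (card S)
           \<longrightarrow> \<phi> S \<le> b * real (card S)))"

lemma bounded_on_almost_invariantE: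
  fixes \<phi> :: "'g set \<Rightarrow> real"
  assumes "bounded_on_almost_invariant G \<phi> b"
  obtains K and \<delta> :: real where "finite K" "K \<subseteq> carrier G" "0 < \<delta>"
    "\<And>S. finite S \<Longrightarrow> S \<subseteq> carrier G \<Longrightarrow> real (card (inner_boundary G K S)) \<le> \<delta> * real (card S)
      \<Longrightarrow> \<phi> S \<le> b * real (card S)"
proof -
  from assms obtain K \<delta> where *: "finite K \<and> K \<subseteq> carrier G \<and> 0 < \<delta> \<and>
        (\<forall>S. finite S \<and> S \<subseteq> carrier G \<and> real (card (inner_boundary G K S)) \<le> \<delta> * real (card S)
           \<longrightarrow> \<phi> S \<le> b * real (card S))"
    unfolding bounded_on_almost_invariant_def by (elim exE)
  show thesis by (rule that[of K \<delta>]) (use * in simp_all)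
qed

lemma inner_boundary_mono: "K \<subseteq> K' \<Longrightarrow> inner_boundary G K S \<subseteq> inner_boundary G K' S"
  by (auto simp: inner_boundary_def)

lemma inner_boundary_subset: "inner_boundary G K S \<subseteq> S"
  by (auto simp: inner_boundary_def)

locale subadditive_set_function = group G for G :: "('g, 'm) monoid_scheme" (structure) +
  fixes \<phi> :: "'g set \<Rightarrow> real"
  assumes nonneg: "finite S \<Longrightarrow> S \<subseteq> carrier G \<Longrightarrow> 0 \<le> \<phi> S"
    and empty_zero: "\<phi> {} = 0"
    and subadd: "finite S \<Longrightarrow> S \<subseteq> carrier G \<Longrightarrow> finite T \<Longrightarrow> T \<subseteq> carrier G \<Longrightarrow>
      \<phi> (S \<union> T) \<le> \<phi> S + \<phi> T"
    and right_invariant: "finite S \<Longrightarrow> S \<subseteq> carrier G \<Longrightarrow> c \<in> carrier G \<Longrightarrow> \<phi> (S #> c) \<le> \<phi> S"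
begin

lemma subadd_UN:
  assumes "finite C" "\<And>c. c \<in> C \<Longrightarrow> finite (S c) \<and> S c \<subseteq> carrier G"
  shows "\<phi> (\<Union>c\<in>C. S c) \<le> (\<Sum>c\<in>C. \<phi> (S c))"
  using assms
proof (induction C rule: finite_induct)
  case empty
  then show ?case by (simp add: empty_zero)
next
  case (insert c C)
  have "\<phi> (S c \<union> (\<Union>c\<in>C. S c)) \<le> \<phi> (S c) + \<phi> (\<Union>c\<in>C. S c)"
    by (rule subadd) (use insert in auto)
  with insert show ?case by simp
qed

lemma le_card:
  assumes "finite S" "S \<subseteq> carrier G"
  shows "\<phi> S \<le> \<phi> {\<one>} * card S"
proof -
  have "\<phi> S = \<phi> (\<Union>s\<in>S. {\<one>} #> s)"
    using assms by (intro arg_cong[of _ _ \<phi>]) (force simp: r_coset_def)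
  also have "\<dots> \<le> (\<Sum>s\<in>S. \<phi> ({\<one>} #> s))"
    using assms by (intro subadd_UN) (auto simp: r_coset_def)
  also have "\<dots> \<le> (\<Sum>s\<in>S. \<phi> {\<one>})"
    using assms by (intro sum_mono right_invariant) auto
  finally show ?thesis by (simp add: mult.commute)
qed

text \<open>A bound \<open>a / (1 - \<epsilon>)\<close> with error term \<open>\<theta>\<close> improves: pack \<open>S\<close> by translates of one very
  invariant \<open>E n\<close>. On the packed part the average is at most \<open>a / (1 - \<epsilon>)\<close>, the denominator paying
  for the overlaps. The remainder, of proportion at most \<open>1 - \<epsilon> / 2\<close>, is either so small that the
  trivial bound suffices, or it is still invariant enough for the previous bound.\<close>

lemma bounded_on_almost_invariant_step:
  fixes a \<epsilon> \<theta> :: real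
  assumes E: "folner_sequence G E" "\<And>n. \<phi> (E n) \<le> a * card (E n)"
    and a: "0 \<le> a" and \<epsilon>: "0 < \<epsilon>" "\<epsilon> < 1" and \<theta>: "0 < \<theta>"
    and hyp: "bounded_on_almost_invariant G \<phi> (a / (1 - \<epsilon>) + \<theta> * \<phi> {\<one>})"
  shows "bounded_on_almost_invariant G \<phi> (a / (1 - \<epsilon>) + (1 - \<epsilon> / 2) * \<theta> * \<phi> {\<one>})"
proof -
  obtain K and \<delta> :: real where K: "finite K" "K \<subseteq> carrier G" and \<delta>: "0 < \<delta>"
    and bound: "\<And>S. finite S \<Longrightarrow> S \<subseteq> carrier G \<Longrightarrow> card (inner_boundary G K S) \<le> \<delta> * card S
      \<Longrightarrow> \<phi> S \<le> (a / (1 - \<epsilon>) + \<theta> * \<phi> {\<one>}) * card S"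
    by (rule bounded_on_almost_invariantE[OF hyp]) (rule that)
  have M: "0 \<le> \<phi> {\<one>}" by (rule nonneg) auto
  \<comment> \<open>This makes \<open>\<delta>' + \<delta>' / (1 - \<epsilon>) \<le> \<delta> \<theta> / 2\<close>: the boundaries of \<open>S\<close> and of the translates together
      remain below \<open>\<delta>\<close> times a remainder of at least \<open>\<theta> / 2\<close> of \<open>S\<close>.\<close>
  define \<delta>' where "\<delta>' = \<delta> * \<theta> * (1 - \<epsilon>) / 4"
  have \<delta>': "0 < \<delta>'" using \<delta> \<theta> \<epsilon> by (simp add: \<delta>'_def)
  define D where "D n = (\<Union>k\<in>m_inv G ` K. k <# E n) - E n" for n
  have "(\<lambda>n. real (card (D n)) / real (card (E n))) \<longlonglongrightarrow> 0"
    unfolding D_def by (rule folner_expansion[OF E(1)]) (use K in auto)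
  then have "\<forall>\<^sub>F n in sequentially. real (card (D n)) / real (card (E n)) < \<delta>'"
    using \<delta>' by (rule order_tendstoD)
  then obtain n where n: "real (card (D n)) / real (card (E n)) < \<delta>'"
    by (auto simp: eventually_sequentially)
  note En = folner_sequenceD[OF E(1), of n]
  have Dn: "real (card (D n)) \<le> \<delta>' * card (E n)"
    using n En(4) by (simp add: field_simps)
  define \<delta>1 where "\<delta>1 = min (1/2) \<delta>'"
  have "\<phi> S \<le> (a / (1 - \<epsilon>) + (1 - \<epsilon> / 2) * \<theta> * \<phi> {\<one>}) * card S"
    if S: "finite S" "S \<subseteq> carrier G" and inv: "card (inner_boundary G (E n \<union> K) S) \<le> \<delta>1 * card S" for S
  proof -
    obtain C where C: "C \<subseteq> S" and US: "(\<Union>c\<in>C. E n #> c) \<subseteq> S"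
      and cardC: "(1 - \<epsilon>) * card (E n) * card C \<le> card (\<Union>c\<in>C. E n #> c)"
      and cardU: "\<epsilon> * card (S - inner_boundary G (E n) S) \<le> card (\<Union>c\<in>C. E n #> c)"
      using greedy_packing[OF S En(1-3) \<epsilon>] by blast
    define U where "U = (\<Union>c\<in>C. E n #> c)"
    have finC: "finite C" using C S(1) by (rule finite_subset)
    have CG: "C \<subseteq> carrier G" using C S(2) by (rule order.trans)
    have U: "U \<subseteq> S" "finite U" using US finite_subset[OF US S(1)] by (auto simp: U_def)
    have mono: "card (inner_boundary G K' S) \<le> \<delta>1 * card S" if "K' \<subseteq> E n \<union> K" for K'
    proof -
      have "card (inner_boundary G K' S) \<le> card (inner_boundary G (E n \<union> K) S)"
        using that S by (intro card_mono inner_boundary_mono finite_subset[OF inner_boundary_subset])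
      with inv show ?thesis by linarith
    qed
    have "card S - card (inner_boundary G (E n) S) = card (S - inner_boundary G (E n) S)"
      using S(1) by (simp add: card_Diff_subset finite_subset[OF inner_boundary_subset] inner_boundary_subset)
    moreover have "card (inner_boundary G (E n) S) \<le> card S"
      using S(1) by (intro card_mono inner_boundary_subset)
    moreover have "card (inner_boundary G (E n) S) \<le> 1/2 * card S"
    proof -
      have "\<delta>1 * card S \<le> 1/2 * card S" by (intro mult_right_mono) (auto simp: \<delta>1_def)
      with mono[of "E n"] show ?thesis by simp
    qed
    ultimately have "card S / 2 \<le> card (S - inner_boundary G (E n) S)" by linarith
    then have "\<epsilon> * (card S / 2) \<le> \<epsilon> * card (S - inner_boundary G (E n) S)"
      using \<epsilon> by (intro mult_left_mono) auto
    then have large: "\<epsilon> / 2 * card S \<le> card U" using cardU by (simp add: U_def)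
    have cardSU: "real (card (S - U)) = real (card S) - card U"
      using U card_mono[OF S(1) U(1)] by (simp add: card_Diff_subset of_nat_diff)
    have CU: "card (E n) * real (card C) \<le> card U / (1 - \<epsilon>)"
      using cardC \<epsilon> by (simp add: U_def field_simps)
    have "\<phi> U \<le> (\<Sum>c\<in>C. \<phi> (E n #> c))"
      unfolding U_def using CG En
      by (intro subadd_UN finC) (simp add: finite_r_coset r_coset_subset_G subsetD[OF CG])
    also have "\<dots> \<le> (\<Sum>c\<in>C. a * card (E n))"
      using CG by (intro sum_mono order.trans[OF right_invariant[OF En(1,3)] E(2)]) auto
    also have "\<dots> = a * (card (E n) * real (card C))" by simp
    also have "\<dots> \<le> a * (card U / (1 - \<epsilon>))"
      using CU a by (rule mult_left_mono)
    finally have \<phi>U: "\<phi> U \<le> a / (1 - \<epsilon>) * card U" by simp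
    have split: "\<phi> S \<le> \<phi> U + \<phi> (S - U)"
    proof -
      have "U \<union> (S - U) = S" "U \<subseteq> carrier G" "S - U \<subseteq> carrier G" using U S by auto
      then show ?thesis using subadd[of U "S - U"] U S by simp
    qed
    have a': "0 \<le> a / (1 - \<epsilon>)" using a \<epsilon> by simp
    show ?thesis
    proof (cases "card (S - U) \<le> \<theta> / 2 * card S")
      case True
      have "\<phi> (S - U) \<le> \<phi> {\<one>} * card (S - U)" using S by (intro le_card) auto
      also have "\<dots> \<le> \<phi> {\<one>} * ((1 - \<epsilon> / 2) * \<theta> * card S)"
      proof (rule mult_left_mono[OF _ M])
        have "\<theta> / 2 * card S \<le> (1 - \<epsilon> / 2) * \<theta> * card S"
          using \<epsilon> \<theta> by (intro mult_right_mono) (auto simp: field_simps)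
        with True show "card (S - U) \<le> (1 - \<epsilon> / 2) * \<theta> * card S" by linarith
      qed
      finally have "\<phi> S \<le> a / (1 - \<epsilon>) * card U + (1 - \<epsilon> / 2) * \<theta> * \<phi> {\<one>} * card S"
        using split \<phi>U by (simp add: mult_ac)
      also have "a / (1 - \<epsilon>) * card U \<le> a / (1 - \<epsilon>) * card S"
        using card_mono[OF S(1) U(1)] a' by (intro mult_left_mono) auto
      finally show ?thesis by (simp only: distrib_right)
    next
      case False
      have "card (inner_boundary G K (S - U)) \<le> card (inner_boundary G K S) + card C * card (D n)"
        unfolding U_def D_def by (rule inner_boundary_Diff_packing) (use S En K C in auto)
      then have "card (inner_boundary G K (S - U)) \<le> card (inner_boundary G K S) + real (card C) * card (D n)"
        by (simp flip: of_nat_mult of_nat_add)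
      also have "\<dots> \<le> \<delta>1 * card S + real (card C) * (\<delta>' * card (E n))"
        using mono[of K] Dn by (intro add_mono mult_left_mono) auto
      also have "\<dots> \<le> \<delta>' * card S + \<delta>' * (card S / (1 - \<epsilon>))"
      proof (rule add_mono)
        show "\<delta>1 * card S \<le> \<delta>' * card S" by (intro mult_right_mono) (auto simp: \<delta>1_def)
        have "card (E n) * real (card C) \<le> card S / (1 - \<epsilon>)"
          using CU by (rule order.trans) (use card_mono[OF S(1) U(1)] \<epsilon> in \<open>auto intro!: divide_right_mono\<close>)
        then have "\<delta>' * (card (E n) * real (card C)) \<le> \<delta>' * (card S / (1 - \<epsilon>))"
          using \<delta>' by (intro mult_left_mono) auto
        then show "real (card C) * (\<delta>' * card (E n)) \<le> \<delta>' * (card S / (1 - \<epsilon>))"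
          by (simp add: mult_ac)
      qed
      also have "\<dots> \<le> \<delta> * (\<theta> / 2 * card S)"
      proof -
        have "\<delta>' + \<delta>' / (1 - \<epsilon>) = \<delta> * \<theta> / 4 * (1 - \<epsilon> + 1)"
          using \<epsilon> by (simp add: \<delta>'_def field_simps)
        also have "\<dots> \<le> \<delta> * \<theta> / 4 * 2"
          using \<epsilon> \<delta> \<theta> by (intro mult_left_mono) auto
        finally have "(\<delta>' + \<delta>' / (1 - \<epsilon>)) * card S \<le> (\<delta> * \<theta> / 4 * 2) * card S"
          by (rule mult_right_mono) simp
        then show ?thesis by (simp add: algebra_simps)
      qed
      also have "\<dots> \<le> \<delta> * card (S - U)" using False \<delta> by (intro mult_left_mono) auto
      finally have "\<phi> (S - U) \<le> (a / (1 - \<epsilon>) + \<theta> * \<phi> {\<one>}) * card (S - U)"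
        using S by (intro bound) auto
      with split \<phi>U have "\<phi> S \<le> a / (1 - \<epsilon>) * (card U + card (S - U)) + \<theta> * \<phi> {\<one>} * card (S - U)"
        by (simp only: of_nat_add distrib_left distrib_right)
      also have "real (card U + card (S - U)) = card S" using cardSU by simp
      also have "\<theta> * \<phi> {\<one>} * card (S - U) \<le> \<theta> * \<phi> {\<one>} * ((1 - \<epsilon> / 2) * card S)"
        using large cardSU \<theta> M by (intro mult_left_mono) (auto simp: algebra_simps)
      finally show ?thesis by (simp add: distrib_left mult_ac)
    qed
  qed
  moreover have "0 < \<delta>1" using \<delta>' by (simp add: \<delta>1_def)
  ultimately show ?thesis
    unfolding bounded_on_almost_invariant_def using K En
    by (intro exI[of _ "E n \<union> K"] exI[of _ \<delta>1]) auto
qed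

text \<open>Each step of the iteration multiplies the error term by the same factor \<open>q < 1\<close>. It starts from
  the trivial bound by \<open>\<phi> {\<one>}\<close> times the cardinality.\<close>

lemma eventually_le_of_folner_bound:
  fixes a e :: real
  assumes E: "folner_sequence G E" "\<And>n. \<phi> (E n) \<le> a * card (E n)"
    and a: "0 \<le> a" and e: "0 < e" and F: "folner_sequence G F"
  shows "\<forall>\<^sub>F n in sequentially. \<phi> (F n) / card (F n) \<le> a + e"
proof -
  \<comment> \<open>Half of \<open>e\<close> is spent on the overlaps, the other half on the error after sufficiently many steps.\<close>
  define \<epsilon> where "\<epsilon> = e / (2 * (a + e))"
  have \<epsilon>: "0 < \<epsilon>" "\<epsilon> < 1" using a e by (auto simp: \<epsilon>_def field_simps)
  have a_bound: "a / (1 - \<epsilon>) \<le> a + e / 2"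
  proof -
    have "(a + e / 2) * (1 - \<epsilon>) = a + e * e / (4 * (a + e))"
      using a e by (simp add: \<epsilon>_def field_simps)
    moreover have "0 \<le> e * e / (4 * (a + e))" using a e by simp
    ultimately have "a \<le> (a + e / 2) * (1 - \<epsilon>)" by linarith
    then show ?thesis using \<epsilon> by (simp add: pos_divide_le_eq)
  qed
  define q where "q = 1 - \<epsilon> / 2"
  have q: "0 < q" "q < 1" using \<epsilon> by (auto simp: q_def)
  have M: "0 \<le> \<phi> {\<one>}" by (rule nonneg) auto
  have iter: "bounded_on_almost_invariant G \<phi> (a / (1 - \<epsilon>) + q ^ r * \<phi> {\<one>})" for r
  proof (induction r)
    case 0
    have "\<phi> S \<le> (a / (1 - \<epsilon>) + 1 * \<phi> {\<one>}) * card S" if "finite S" "S \<subseteq> carrier G" for S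
    proof -
      have "0 \<le> a / (1 - \<epsilon>) * card S" using a \<epsilon> by simp
      with le_card[OF that] show ?thesis by (simp only: distrib_right mult_1)
    qed
    then show ?case 
      unfolding bounded_on_almost_invariant_def by (intro exI[of _ "{}"] exI[of _ 1]) auto
  next
    case (Suc r)
    show ?case
      using bounded_on_almost_invariant_step[OF E a \<epsilon> _ Suc] q by (simp add: q_def mult_ac)
  qed
  have "(\<lambda>r. q ^ r * \<phi> {\<one>}) \<longlonglongrightarrow> 0 * \<phi> {\<one>}"
    using q by (intro tendsto_mult_right LIMSEQ_power_zero) auto
  then have "\<forall>\<^sub>F r in sequentially. q ^ r * \<phi> {\<one>} < e / 2"
    using e by (intro order_tendstoD(2)[where y = "0 * \<phi> {\<one>}"]) auto
  then obtain r where r: "q ^ r * \<phi> {\<one>} < e / 2" by (auto simp: eventually_sequentially)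
  obtain K and \<delta> :: real where K: "finite K" "K \<subseteq> carrier G" and \<delta>: "0 < \<delta>"
    and bound: "\<And>S. finite S \<Longrightarrow> S \<subseteq> carrier G \<Longrightarrow> card (inner_boundary G K S) \<le> \<delta> * card S
      \<Longrightarrow> \<phi> S \<le> (a / (1 - \<epsilon>) + q ^ r * \<phi> {\<one>}) * card S"
    by (rule bounded_on_almost_invariantE[OF iter[of r]]) (rule that)
  have "\<forall>\<^sub>F n in sequentially. real (card (inner_boundary G K (F n))) / real (card (F n)) < \<delta>"
    using folner_inner_boundary[OF F K] \<delta> by (rule order_tendstoD)
  then show ?thesis
  proof eventually_elim
    case (elim n)
    note Fn = folner_sequenceD[OF F, of n]
    have "\<phi> (F n) \<le> (a / (1 - \<epsilon>) + q ^ r * \<phi> {\<one>}) * card (F n)"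
      using elim Fn by (intro bound) (auto simp: field_simps)
    also have "\<dots> \<le> (a + e) * card (F n)"
      using a_bound r by (intro mult_right_mono) auto
    finally show ?case using Fn by (simp add: pos_divide_le_eq)
  qed
qed

text \<open>The limit is the least asymptotic average that some Folner sequence attains: no Folner sequence
  can do worse in the limit, by the previous lemma, and a subsequence that did better would itself
  be a Folner sequence.\<close>

theorem ornstein_weiss:
  assumes F0: "folner_sequence G F0"
  shows "\<exists>L. \<forall>F. folner_sequence G F \<longrightarrow> (\<lambda>n. \<phi> (F n) / card (F n)) \<longlonglongrightarrow> L"
proof -
  define A where "A = {a::real. 0 \<le> a \<and> (\<exists>E. folner_sequence G E \<and> (\<forall>n. \<phi> (E n) \<le> a * card (E n)))}"
  have "\<phi> {\<one>} \<in> A"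
    using F0 le_card folner_sequenceD[OF F0] nonneg[of "{\<one>}"] by (auto simp: A_def)
  then have ne: "A \<noteq> {}" by auto
  have bdd: "bdd_below A" by (rule bdd_belowI[of _ 0]) (auto simp: A_def)
  have "(\<lambda>n. \<phi> (F n) / card (F n)) \<longlonglongrightarrow> Inf A" if F: "folner_sequence G F" for F
  proof (rule order_tendstoI)
    fix u assume "Inf A < u"
    then obtain a where a: "a \<in> A" "a < u" using cInf_lessD[OF ne] by blast
    then obtain E where "folner_sequence G E" "\<And>n. \<phi> (E n) \<le> a * card (E n)" "0 \<le> a" by (auto simp: A_def)
    from eventually_le_of_folner_bound[OF this _ F, of "(u - a) / 2"] a
    have "\<forall>\<^sub>F n in sequentially. \<phi> (F n) / card (F n) \<le> a + (u - a) / 2" by simp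
    then show "\<forall>\<^sub>F n in sequentially. \<phi> (F n) / card (F n) < u"
      by eventually_elim (use a in \<open>simp add: field_simps\<close>)
  next
    fix l assume l: "l < Inf A"
    show "\<forall>\<^sub>F n in sequentially. l < \<phi> (F n) / card (F n)"
    proof (rule ccontr)
      assume "\<not> ?thesis"
      then have freq: "\<exists>\<^sub>F n in sequentially. \<phi> (F n) / card (F n) \<le> l"
        by (simp add: frequently_def not_le)
      then have "infinite {n. \<phi> (F n) / card (F n) \<le> l}"
        by (simp add: frequently_sequentially infinite_nat_iff_unbounded_le)
      from infinite_enumerate[OF this] obtain r :: "nat \<Rightarrow> nat"
        where r: "strict_mono r" "\<And>n. \<phi> (F (r n)) / card (F (r n)) \<le> l" by auto
      have "0 \<le> \<phi> (F (r 0)) / card (F (r 0))"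
        using folner_sequenceD[OF F] by (intro divide_nonneg_nonneg nonneg) auto
      then have "0 \<le> l" using r(2)[of 0] by linarith
      moreover have "\<phi> (F (r n)) \<le> l * card (F (r n))" for n
        using r(2)[of n] folner_sequenceD(4)[OF F, of "r n"] by (simp add: pos_divide_le_eq)
      ultimately have "l \<in> A" using folner_sequence_subseq[OF F r(1)] by (auto simp: A_def)
      then have "Inf A \<le> l" using bdd by (rule cInf_lower)
      with l show False by simp
    qed
  qed
  then show ?thesis by blast
qed

end

section \<open>Densities of unions of cosets, and separated translates\<close>

text \<open>This value depends on \<open>H\<close> only formally: for \<open>H\<close>-invariant \<open>Q\<close> it is the limiting frequency of
  \<open>Q\<close> in every Folner sequence, see \<open>folner_density\<close>.\<close>

definition coset_density :: "('g, 'm) monoid_scheme \<Rightarrow> 'g set \<Rightarrow> 'g set \<Rightarrow> real" where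
  "coset_density G H Q = card {C \<in> rcosets\<^bsub>G\<^esub> H. C \<subseteq> Q} / card (rcosets\<^bsub>G\<^esub> H)"

definition left_invariant_under :: "('g, 'm) monoid_scheme \<Rightarrow> 'g set \<Rightarrow> 'g set \<Rightarrow> bool" where
  "left_invariant_under G H Q \<longleftrightarrow> Q \<subseteq> carrier G \<and> (\<forall>h\<in>H. \<forall>q\<in>Q. h \<otimes>\<^bsub>G\<^esub> q \<in> Q)"

lemma (in group) rcosets_Union_subset:
  assumes H: "subgroup H G" and Q: "left_invariant_under G H Q"
  shows "\<Union>{C \<in> rcosets H. C \<subseteq> Q} = Q"
proof
  show "Q \<subseteq> \<Union>{C \<in> rcosets H. C \<subseteq> Q}"
  proof
    fix q assume q: "q \<in> Q"
    then have qG: "q \<in> carrier G" using Q by (auto simp: left_invariant_under_def)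
    have "H #> q \<in> rcosets H" using qG H by (simp add: rcosetsI subgroup.subset)
    moreover have "H #> q \<subseteq> Q" using Q q by (auto simp: left_invariant_under_def r_coset_def)
    moreover have "q \<in> H #> q" by (rule rcos_self[OF qG H])
    ultimately show "q \<in> \<Union>{C \<in> rcosets H. C \<subseteq> Q}" by blast
  qed
qed auto

lemma (in group) rcosets_eq_if_meet:
  assumes "subgroup H G" "C \<in> rcosets H" "D \<in> rcosets H" "g \<in> C" "g \<in> D"
  shows "C = D"
  using rcos_disjoint[OF assms(1)] assms by (auto simp: pairwise_def disjnt_def)

lemma (in group) card_Int_Union_rcosets:
  assumes "subgroup H G" "finite S" "finite \<Q>" "\<Q> \<subseteq> rcosets H"
  shows "card (S \<inter> \<Union>\<Q>) = (\<Sum>C\<in>\<Q>. card (S \<inter> C))"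
proof -
  have "(S \<inter> C) \<inter> (S \<inter> D) = {}" if "C \<in> \<Q>" "D \<in> \<Q>" "C \<noteq> D" for C D
    using rcosets_eq_if_meet[OF assms(1), of C D] that assms(4) by blast
  then have "card (\<Union>C\<in>\<Q>. S \<inter> C) = (\<Sum>C\<in>\<Q>. card (S \<inter> C))"
    using assms(2,3) by (intro card_UN_disjoint) auto
  moreover have "S \<inter> \<Union>\<Q> = (\<Union>C\<in>\<Q>. S \<inter> C)" by auto
  ultimately show ?thesis by (simp only:)
qed

text \<open>Folner sets equidistribute modulo \<open>H\<close>: any two cosets are left translates of each other, so
  almost invariant sets meet them in almost the same number of elements, and these numbers add up
  to the size of the set.\<close>

lemma (in group) folner_coset_limit:
  assumes F: "folner_sequence G F" and H: "H \<lhd> G" and fin: "finite (rcosets H)" and C: "C \<in> rcosets H"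
  shows "(\<lambda>n. card (F n \<inter> C) / card (F n)) \<longlonglongrightarrow> 1 / card (rcosets H)"
proof -
  interpret H: normal H G by (rule H)
  have sub: "subgroup H G" by (rule H.subgroup_axioms)
  define f where "f D n = real (card (F n \<inter> D)) / card (F n)" for D n
  have diff: "(\<lambda>n. f C n - f D n) \<longlonglongrightarrow> 0" if D: "D \<in> rcosets H" for D
  proof -
    obtain a b where a: "a \<in> carrier G" "C = H #> a" and b: "b \<in> carrier G" "D = H #> b"
      using C D by (auto simp: RCOSETS_def)
    define g where "g = b \<otimes> inv a"
    have g: "g \<in> carrier G" using a b by (simp add: g_def)
    have gC: "g <# C = D"
    proof -
      have "g <# C = g <# (a <# H)" using a H.coset_eq by auto
      also have "\<dots> = b <# H" using a b H.subset by (simp add: lcos_m_assoc g_def m_assoc)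
      finally show ?thesis using b H.coset_eq by auto
    qed
    have CG: "C \<subseteq> carrier G" using a H.subset by (simp add: r_coset_subset_G)
    show ?thesis
    proof (rule Lim_null_comparison[where g = "\<lambda>n. real (card (sym_diff (g <# F n) (F n))) / real (card (F n))"])
      show "(\<lambda>n. real (card (sym_diff (g <# F n) (F n))) / real (card (F n))) \<longlonglongrightarrow> 0"
        using F g by (auto simp: folner_sequence_def)
      have "\<bar>f C n - f D n\<bar> \<le> real (card (sym_diff (g <# F n) (F n))) / real (card (F n))" for n
      proof -
        note Fn = folner_sequenceD[OF F, of n]
        have fin': "finite (g <# F n)" using Fn by (simp add: finite_l_coset)
        have "g <# (F n \<inter> C) = (g <# F n) \<inter> D"
        proof -
          have "inj_on (\<lambda>x. g \<otimes> x) (carrier G)" using g by (auto intro!: inj_onI simp: left_cancel)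
          then have "(\<lambda>x. g \<otimes> x) ` (F n \<inter> C) = (\<lambda>x. g \<otimes> x) ` F n \<inter> (\<lambda>x. g \<otimes> x) ` C"
            using Fn CG by (intro inj_on_image_Int) auto
          then show ?thesis unfolding gC[symmetric] by (auto simp: l_coset_def)
        qed
        then have eq: "card ((g <# F n) \<inter> D) = card (F n \<inter> C)"
          using card_l_coset[of "F n \<inter> C" g] Fn g by (metis inf.coboundedI1)
        have "card ((g <# F n) \<inter> D) \<le> card ((F n \<inter> D) \<union> sym_diff (g <# F n) (F n))"
          using Fn fin' by (intro card_mono) auto
        then have 1: "card (F n \<inter> C) \<le> card (F n \<inter> D) + card (sym_diff (g <# F n) (F n))"
          unfolding eq by (rule order.trans[OF _ card_Un_le])
        have "card (F n \<inter> D) \<le> card (((g <# F n) \<inter> D) \<union> sym_diff (g <# F n) (F n))"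
          using Fn fin' by (intro card_mono) auto
        then have 2: "card (F n \<inter> D) \<le> card (F n \<inter> C) + card (sym_diff (g <# F n) (F n))"
          unfolding eq[symmetric] by (rule order.trans[OF _ card_Un_le])
        have "\<bar>f C n - f D n\<bar> = \<bar>real (card (F n \<inter> C)) - card (F n \<inter> D)\<bar> / card (F n)"
          by (simp add: f_def flip: diff_divide_distrib)
        also have "\<dots> \<le> real (card (sym_diff (g <# F n) (F n))) / real (card (F n))"
          using 1 2 by (intro divide_right_mono) linarith+
        finally show ?thesis .
      qed
      then show "\<forall>\<^sub>F n in sequentially. norm (f C n - f D n)
          \<le> real (card (sym_diff (g <# F n) (F n))) / real (card (F n))"
        by simp
    qed
  qed
  have total: "(\<Sum>D\<in>rcosets H. f D n) = 1" for n
  proof -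
    note Fn = folner_sequenceD[OF F, of n]
    have "card (F n) = card (F n \<inter> \<Union>(rcosets H))"
      using Fn rcosets_part_G[OF sub] by (intro arg_cong[of _ _ card]) auto
    also have "\<dots> = (\<Sum>D\<in>rcosets H. card (F n \<inter> D))"
      using Fn fin by (intro card_Int_Union_rcosets[OF sub]) auto
    finally have "real (card (F n)) = (\<Sum>D\<in>rcosets H. real (card (F n \<inter> D)))"
      by (simp flip: of_nat_sum)
    then show ?thesis using Fn by (simp add: f_def flip: sum_divide_distrib)
  qed
  have pos: "0 < card (rcosets H)" using fin C by (auto simp: card_gt_0_iff)
  have "(\<lambda>n. \<Sum>D\<in>rcosets H. f C n - f D n) \<longlonglongrightarrow> 0"
    using diff by (intro tendsto_null_sum)
  then have "(\<lambda>n. card (rcosets H) * f C n - 1) \<longlonglongrightarrow> 0"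
    by (simp add: sum_subtractf total)
  then have "(\<lambda>n. (card (rcosets H) * f C n - 1) / card (rcosets H) + 1 / card (rcosets H)) \<longlonglongrightarrow> 0 / card (rcosets H) + 1 / card (rcosets H)"
    by (intro tendsto_intros) (use pos in auto)
  then show ?thesis using pos by (simp add: f_def diff_divide_distrib)
qed

lemma (in group) folner_density:
  assumes F: "folner_sequence G F" and H: "H \<lhd> G" and fin: "finite (rcosets H)"
    and Q: "left_invariant_under G H Q"
  shows "(\<lambda>n. card (F n \<inter> Q) / card (F n)) \<longlonglongrightarrow> coset_density G H Q"
proof -
  have sub: "subgroup H G" using H by (rule normal_imp_subgroup)
  define \<Q> where "\<Q> = {C \<in> rcosets H. C \<subseteq> Q}"
  have \<Q>: "finite \<Q>" "\<Union>\<Q> = Q" using fin rcosets_Union_subset[OF sub Q] by (auto simp: \<Q>_def)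
  have eq: "real (card (F n \<inter> Q)) / card (F n) = (\<Sum>C\<in>\<Q>. card (F n \<inter> C) / card (F n))" for n
  proof -
    note Fn = folner_sequenceD[OF F, of n]
    have "card (F n \<inter> \<Union>\<Q>) = (\<Sum>C\<in>\<Q>. card (F n \<inter> C))"
      using Fn \<Q>(1) by (intro card_Int_Union_rcosets[OF sub]) (auto simp: \<Q>_def)
    then show ?thesis by (simp add: \<Q>(2) flip: sum_divide_distrib)
  qed
  have "(\<lambda>n. \<Sum>C\<in>\<Q>. card (F n \<inter> C) / card (F n)) \<longlonglongrightarrow> (\<Sum>C\<in>\<Q>. 1 / card (rcosets H))"
    by (intro tendsto_sum folner_coset_limit[OF F H fin]) (auto simp: \<Q>_def)
  then show ?thesis unfolding eq by (simp add: coset_density_def \<Q>_def)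
qed

text \<open>Right translations commute with the left translations of the Folner condition. This turns the
  frequency of \<open>Q\<close> in \<open>F n\<close> into its frequency at any position \<open>a\<close>, by looking at \<open>F n #> a\<close>.\<close>

lemma (in group) folner_sequence_r_coset:
  assumes F: "folner_sequence G F" and c: "c \<in> carrier G"
  shows "folner_sequence G (\<lambda>n. F n #> c)"
proof -
  have eq: "card (sym_diff (g <# (F n #> c)) (F n #> c)) = card (sym_diff (g <# F n) (F n))" 
    if g: "g \<in> carrier G" for g n
  proof -
    note Fn = folner_sequenceD[OF F, of n]
    have gF: "g <# F n \<subseteq> carrier G" using g Fn by (simp add: l_coset_subset_G)
    have inj: "inj_on (\<lambda>x. x \<otimes> c) (carrier G)" using c by (auto intro!: inj_onI)
    have r: "X #> c = (\<lambda>x. x \<otimes> c) ` X" for X by (auto simp: r_coset_def)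
    have "g <# (F n #> c) = (g <# F n) #> c" using g c Fn by (auto simp: l_coset_def r_coset_def subset_iff m_assoc)
    then have "sym_diff (g <# (F n #> c)) (F n #> c) = sym_diff (g <# F n) (F n) #> c"
      using inj_on_image_set_diff[OF inj, of "g <# F n" "F n"] inj_on_image_set_diff[OF inj, of "F n" "g <# F n"] gF Fn
      by (simp add: r image_Un Diff_subset_conv le_supI2)
    then show ?thesis using card_r_coset[of "sym_diff (g <# F n) (F n)" c] gF Fn c by auto
  qed
  have "F n #> c \<noteq> {}" for n using folner_sequenceD(2)[OF F, of n] by (auto simp: r_coset_def)
  then show ?thesis
    using F c eq by (simp add: folner_sequence_def finite_r_coset r_coset_subset_G card_r_coset)
qed

text \<open>Room for arbitrarily many disjoint copies of \<open>B\<close>: each chosen translate forbids only finitely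
  many later ones.\<close>

lemma (in group) separated_translates:
  assumes B: "finite B" "B \<subseteq> carrier G" and S: "infinite S" "S \<subseteq> carrier G"
  shows "\<exists>\<Gamma>. \<Gamma> \<subseteq> S \<and> finite \<Gamma> \<and> card \<Gamma> = N \<and>
    (\<forall>\<gamma>\<in>\<Gamma>. \<forall>\<gamma>'\<in>\<Gamma>. \<forall>b\<in>B. \<forall>b'\<in>B. b \<otimes> \<gamma> = b' \<otimes> \<gamma>' \<longrightarrow> \<gamma> = \<gamma>')"
proof (induction N)
  case 0
  show ?case by (rule exI[of _ "{}"]) auto
next
  case (Suc N)
  then obtain \<Gamma> where \<Gamma>: "\<Gamma> \<subseteq> S" "finite \<Gamma>" "card \<Gamma> = N"
    and sep: "\<And>\<gamma> \<gamma>' b b'. \<gamma> \<in> \<Gamma> \<Longrightarrow> \<gamma>' \<in> \<Gamma> \<Longrightarrow> b \<in> B \<Longrightarrow> b' \<in> B \<Longrightarrow> b \<otimes> \<gamma> = b' \<otimes> \<gamma>' \<Longrightarrow> \<gamma> = \<gamma>'"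
    by metis
  define bad where "bad = \<Gamma> \<union> (\<lambda>(b, b', \<gamma>). inv b' \<otimes> (b \<otimes> \<gamma>)) ` (B \<times> B \<times> \<Gamma>)"
  have "finite bad" using B \<Gamma> by (simp add: bad_def)
  then obtain \<delta> where \<delta>: "\<delta> \<in> S" "\<delta> \<notin> bad" using S(1) by (meson finite_subset subsetI)
  have new: "b \<otimes> \<gamma> \<noteq> b' \<otimes> \<delta>" if "b \<in> B" "b' \<in> B" "\<gamma> \<in> \<Gamma>" for b b' \<gamma>
  proof
    assume "b \<otimes> \<gamma> = b' \<otimes> \<delta>"
    moreover have "b' \<in> carrier G" "\<delta> \<in> carrier G" using that \<delta> B S by auto
    ultimately have "\<delta> = inv b' \<otimes> (b \<otimes> \<gamma>)" by (simp add: m_assoc[symmetric])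
    with \<delta>(2) that show False by (force simp: bad_def)
  qed
  show ?case
  proof (intro exI[of _ "insert \<delta> \<Gamma>"] conjI ballI impI)
    fix \<gamma> \<gamma>' b b' assume *: "\<gamma> \<in> insert \<delta> \<Gamma>" "\<gamma>' \<in> insert \<delta> \<Gamma>" "b \<in> B" "b' \<in> B" "b \<otimes> \<gamma> = b' \<otimes> \<gamma>'"
    show "\<gamma> = \<gamma>'"
    proof (cases "\<gamma> = \<delta>")
      case True
      then show ?thesis using * new[of b' b \<gamma>'] by auto
    next
      case False
      then show ?thesis using * new[of b b' \<gamma>] sep[of \<gamma> \<gamma>' b b'] by auto
    qed
  qed (use \<Gamma> \<delta> in \<open>auto simp: bad_def\<close>)
qed

section \<open>Residual chains\<close>

locale residual_chain = group G for G :: "('g, 'm) monoid_scheme" (structure) +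
  fixes H :: "nat \<Rightarrow> 'g set"
  assumes normal: "H n \<lhd> G" and finite_index: "finite (rcosets (H n))"
    and H_Suc: "H (Suc n) \<subseteq> H n" and Inter_H: "(\<Inter>n. H n) = {\<one>}"
    and infinite_carrier: "infinite (carrier G)"
begin

lemma H_antimono: "k \<le> k' \<Longrightarrow> H k' \<subseteq> H k"
  using H_Suc by (rule lift_Suc_antimono_le)

lemma subgroup_H: "subgroup (H k) G"
  using normal by (rule normal_imp_subgroup)

lemma H_subset: "H k \<subseteq> carrier G"
  using subgroup_H by (rule subgroup.subset)

text \<open>Deep subgroups of the chain see any finite part of the group injectively.\<close>

lemma eventually_separates:
  assumes Z: "finite Z" "Z \<subseteq> carrier G"
  shows "\<forall>\<^sub>F k in sequentially. \<forall>y\<in>Z. \<forall>z\<in>Z. H k #> y = H k #> z \<longrightarrow> y = z"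
proof (intro eventually_ball_finite ballI Z(1))
  fix y z assume yz: "y \<in> Z" "z \<in> Z"
  then have G: "y \<in> carrier G" "z \<in> carrier G" using Z by auto
  show "\<forall>\<^sub>F k in sequentially. H k #> y = H k #> z \<longrightarrow> y = z"
  proof (cases "y = z")
    case False
    have "y \<otimes> inv z \<noteq> \<one>" using False G by (metis inv_closed inv_equality inv_inv)
    then obtain k0 where k0: "y \<otimes> inv z \<notin> H k0" using Inter_H by blast
    have "H k #> y \<noteq> H k #> z" if "k0 \<le> k" for k
    proof
      assume "H k #> y = H k #> z"
      then have "y \<in> H k #> z" using rcos_self[OF G(1) subgroup_H] by auto
      then obtain h where h: "h \<in> H k" "y = h \<otimes> z" by (auto simp: r_coset_def)
      have hG: "h \<in> carrier G" using h(1) H_subset by auto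
      have "y \<otimes> inv z = h" using G h(2) by (simp add: m_assoc hG)
      with h k0 H_antimono[OF that] show False by auto
    qed
    then show ?thesis by (intro eventually_sequentiallyI[of k0]) simp
  qed simp
qed

lemma eventually_index_ge: "\<forall>\<^sub>F k in sequentially. N \<le> card (rcosets (H k))"
proof -
  obtain Z where Z: "Z \<subseteq> carrier G" "finite Z" "card Z = N"
    using infinite_arbitrarily_large[OF infinite_carrier] by blast
  from eventually_separates[OF Z(2,1)] show ?thesis
  proof eventually_elim
    case (elim k)
    then have "inj_on (\<lambda>z. H k #> z) Z" by (auto intro: inj_onI)
    moreover have "(\<lambda>z. H k #> z) ` Z \<subseteq> rcosets (H k)" using Z H_subset by (auto intro: rcosetsI)
    ultimately have "card Z \<le> card (rcosets (H k))" using finite_index by (rule card_inj_on_le)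
    then show ?case using Z by simp
  qed
qed

lemma infinite_H: "infinite (H k)"
proof
  assume "finite (H k)"
  then have "finite (\<Union>(rcosets (H k)))"
    using finite_index by (auto simp: RCOSETS_def finite_r_coset)
  then show False using infinite_carrier rcosets_part_G[OF subgroup_H] by simp
qed

text \<open>Folner sets become unbounded since, by equidistribution, they eventually meet every coset of
  any fixed subgroup of the chain, and the indices are unbounded.\<close>

lemma folner_card_at_top:
  assumes F: "folner_sequence G F"
  shows "filterlim (\<lambda>n. real (card (F n))) at_top sequentially"
  unfolding filterlim_at_top
proof
  fix N :: real
  obtain k where k: "nat \<lceil>N\<rceil> \<le> card (rcosets (H k))"
    using eventually_index_ge[of "nat \<lceil>N\<rceil>"] by (auto simp: eventually_sequentially)
  have "\<forall>\<^sub>F n in sequentially. \<forall>C\<in>rcosets (H k). F n \<inter> C \<noteq> {}"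
  proof (intro eventually_ball_finite finite_index ballI)
    fix C assume C: "C \<in> rcosets (H k)"
    then have "0 < card (rcosets (H k))" using finite_index by (auto simp: card_gt_0_iff)
    then have "\<forall>\<^sub>F n in sequentially. 0 < real (card (F n \<inter> C)) / card (F n)"
      by (intro order_tendstoD(1)[OF folner_coset_limit[OF F normal finite_index C]]) auto
    then show "\<forall>\<^sub>F n in sequentially. F n \<inter> C \<noteq> {}"
      by eventually_elim auto
  qed
  then show "\<forall>\<^sub>F n in sequentially. N \<le> real (card (F n))"
  proof eventually_elim
    case (elim n)
    note Fn = folner_sequenceD[OF F, of n]
    have "C \<in> (\<lambda>g. H k #> g) ` F n" if C: "C \<in> rcosets (H k)" for C
    proof -
      obtain g where g: "g \<in> F n" "g \<in> C" using elim C by blast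
      then have gG: "g \<in> carrier G" using Fn by auto
      have "H k #> g = C"
        using rcosets_eq_if_meet[OF subgroup_H _ C rcos_self[OF gG subgroup_H] g(2)] gG H_subset
        by (simp add: rcosetsI)
      with g show ?thesis by auto
    qed
    then have "card (rcosets (H k)) \<le> card ((\<lambda>g. H k #> g) ` F n)"
      using Fn by (intro card_mono) auto
    also have "\<dots> \<le> card (F n)" using Fn by (intro card_image_le)
    finally show ?case using k by linarith
  qed
qed

text \<open>The density may be computed at any deeper level: both values are the limit of the same
  frequencies.\<close>

lemma coset_density_mono_level:
  assumes F: "folner_sequence G F" and Q: "left_invariant_under G (H k) Q" and "k \<le> k'"
  shows "left_invariant_under G (H k') Q" "coset_density G (H k') Q = coset_density G (H k) Q"
proof -
  show inv: "left_invariant_under G (H k') Q"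
    using Q H_antimono[OF assms(3)] by (auto simp: left_invariant_under_def)
  show "coset_density G (H k') Q = coset_density G (H k) Q"
    using folner_density[OF F normal finite_index inv] folner_density[OF F normal finite_index Q]
    by (rule LIMSEQ_unique)
qed

end

section \<open>Filling holes\<close>

locale toeplitz_construction = residual_chain G H
  for G :: "('g, 'm) monoid_scheme" (structure) and H :: "nat \<Rightarrow> 'g set" +
  fixes F :: "nat \<Rightarrow> 'g set" and A :: "'a set" and d :: real
  assumes folner: "folner_sequence G F"
    and finite_A: "finite A" and A_nonempty: "A \<noteq> {}"
    and d_nonneg: "0 \<le> d"
begin

text \<open>The values of \<open>x\<close> on the set \<open>Q\<close> of holes are meaningless placeholders; a total function avoids
  having to treat the undecided positions separately.\<close>

definition partial_toeplitz :: "nat \<Rightarrow> 'g set \<Rightarrow> ('g \<Rightarrow> 'a) \<Rightarrow> bool" where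
  "partial_toeplitz k Q x \<longleftrightarrow> left_invariant_under G (H k) Q \<and>
     (\<forall>\<gamma>\<in>H k. \<forall>g\<in>carrier G - Q. x (\<gamma> \<otimes> g) = x g) \<and> x \<in> carrier G \<rightarrow> A"

lemma rcoset_r_mult:
  assumes "\<gamma> \<in> H k" "g \<in> carrier G"
  shows "H k #> (\<gamma> \<otimes> g) = H k #> g"
proof -
  have \<gamma>: "\<gamma> \<in> carrier G" using assms(1) H_subset by auto
  then have "H k #> (\<gamma> \<otimes> g) = (H k #> \<gamma>) #> g" using assms(2) H_subset by (simp add: coset_mult_assoc)
  also have "H k #> \<gamma> = H k" by (rule coset_join2[OF \<gamma> subgroup_H assms(1)])
  finally show ?thesis .
qed

text \<open>One function \<open>v\<close> that shows every pattern \<open>y\<close> on \<open>B\<close> at the translate of \<open>B\<close> by \<open>\<tau> y\<close>. The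
  translation parameters lie in \<open>H k\<close>, because such translations map the holes of level \<open>k\<close> to
  holes.\<close>

lemma separated_patterns:
  assumes B: "finite B" "B \<subseteq> carrier G" 
  obtains \<tau> v where "\<tau> \<in> (B \<rightarrow>\<^sub>E A) \<rightarrow> H k" "v \<in> UNIV \<rightarrow> A" 
    "\<And>y b. y \<in> B \<rightarrow>\<^sub>E A \<Longrightarrow> b \<in> B \<Longrightarrow> v (b \<otimes> \<tau> y) = y b"
proof -
  define Y where "Y = B \<rightarrow>\<^sub>E A"
  have finY: "finite Y" using B finite_A by (simp add: Y_def finite_PiE)
  obtain \<Gamma> where \<Gamma>: "\<Gamma> \<subseteq> H k" "finite \<Gamma>" "card \<Gamma> = card Y"
    and sep: "\<forall>\<gamma>\<in>\<Gamma>. \<forall>\<gamma>'\<in>\<Gamma>. \<forall>b\<in>B. \<forall>b'\<in>B. b \<otimes> \<gamma> = b' \<otimes> \<gamma>' \<longrightarrow> \<gamma> = \<gamma>'"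
    using separated_translates[OF B infinite_H[of k] H_subset[of k], where N = "card Y"]
    by (elim exE conjE)
  obtain \<tau> where \<tau>: "bij_betw \<tau> Y \<Gamma>"
    using finite_same_card_bij[OF finY \<Gamma>(2)] \<Gamma>(3) by auto
  obtain a0 where a0: "a0 \<in> A" using A_nonempty by auto
  define place where "place = (\<lambda>(b, y). b \<otimes> \<tau> y)"
  have inj: "inj_on place (B \<times> Y)"
  proof (rule inj_onI, clarsimp simp: place_def)
    fix b y b' y' assume *: "b \<in> B" "y \<in> Y" "b' \<in> B" "y' \<in> Y" "b \<otimes> \<tau> y = b' \<otimes> \<tau> y'"
    then have \<tau>\<Gamma>: "\<tau> y \<in> \<Gamma>" "\<tau> y' \<in> \<Gamma>" using \<tau> by (auto simp: bij_betw_def)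
    then have eq: "\<tau> y = \<tau> y'" using sep * by blast
    then have "y = y'" using \<tau> * by (auto simp: bij_betw_def inj_on_def)
    moreover have "b = b'" using * eq B \<tau>\<Gamma> \<Gamma>(1) H_subset[of k] by (metis right_cancel subsetD)
    ultimately show "b = b' \<and> y = y'" by simp
  qed
  define v where "v z = (if z \<in> place ` (B \<times> Y) 
    then snd (inv_into (B \<times> Y) place z) (fst (inv_into (B \<times> Y) place z)) else a0)" for z
  show thesis
  proof (rule that[of \<tau> v])
    show "\<tau> \<in> (B \<rightarrow>\<^sub>E A) \<rightarrow> H k" using \<tau> \<Gamma>(1) by (auto simp: bij_betw_def Y_def)
    show val: "v (b \<otimes> \<tau> y) = y b" if "y \<in> B \<rightarrow>\<^sub>E A" "b \<in> B" for y b
    proof -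
      have by_in: "(b, y) \<in> B \<times> Y" using that by (simp add: Y_def)
      have "b \<otimes> \<tau> y = place (b, y)" by (simp add: place_def)
      then show ?thesis using by_in inv_into_f_f[OF inj by_in] by (simp add: v_def)
    qed
    show "v \<in> UNIV \<rightarrow> A"
    proof
      fix z show "v z \<in> A"
      proof (cases "z \<in> place ` (B \<times> Y)")
        case True
        then obtain b y where "b \<in> B" "y \<in> B \<rightarrow>\<^sub>E A" "z = b \<otimes> \<tau> y" by (auto simp: place_def Y_def)
        then show ?thesis using val[of y b] by (auto simp: PiE_iff)
      qed (simp add: v_def a0)
    qed
  qed
qed

text \<open>One stage. At a deep level \<open>k'\<close> the positions needed for writing all patterns on the holes of a
  Folner set occupy finitely many cosets, while the holes exceed the density \<open>d\<close> by a fixed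
  proportion of a large number of cosets. Hence exactly \<open>\<lfloor>d N\<rfloor> + 1\<close> of the \<open>N\<close> cosets can be kept as
  holes; this is the least number that keeps the density above \<open>d\<close>, as the next stage requires.
  Deciding the given \<open>g\<close> in addition ensures that no position stays a hole forever.\<close>

lemma partial_toeplitz_extend:
  assumes stage: "partial_toeplitz k Q x" and dens: "d < coset_density G (H k) Q" and g: "g \<in> carrier G"
  obtains k' Q' x' B m where
    "partial_toeplitz k' Q' x'" "d < coset_density G (H k') Q'" "coset_density G (H k') Q' \<le> d + 1 / Suc n"
    "Q' \<subseteq> Q" "g \<notin> Q'" "\<And>u. u \<in> carrier G - Q \<Longrightarrow> x' u = x u"
    "n \<le> m" "B \<subseteq> F m" "d * card (F m) \<le> card B"
    "\<And>y. y \<in> B \<rightarrow>\<^sub>E A \<Longrightarrow> \<exists>\<gamma>\<in>carrier G. \<forall>b\<in>B. b \<otimes> \<gamma> \<notin> Q' \<and> x' (b \<otimes> \<gamma>) = y b"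
proof -
  have Q: "left_invariant_under G (H k) Q" and xA: "x \<in> carrier G \<rightarrow> A"
    and xinv: "\<And>\<gamma> u. \<gamma> \<in> H k \<Longrightarrow> u \<in> carrier G - Q \<Longrightarrow> x (\<gamma> \<otimes> u) = x u"
    using stage by (auto simp: partial_toeplitz_def)
  define D where "D = coset_density G (H k) Q"
  have dD: "d < D" using dens by (simp add: D_def)
  have QG: "Q \<subseteq> carrier G" using Q by (simp add: left_invariant_under_def)
  have "\<forall>\<^sub>F m in sequentially. d < card (F m \<inter> Q) / card (F m)"
    using folner_density[OF folner normal finite_index Q] dD unfolding D_def by (rule order_tendstoD)
  then have "\<forall>\<^sub>F m in sequentially. d < card (F m \<inter> Q) / card (F m) \<and> n \<le> m"
    using eventually_ge_at_top by (rule eventually_conj)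
  then obtain m where m: "d < card (F m \<inter> Q) / card (F m)" "n \<le> m"
    by (auto simp: eventually_sequentially)
  note Fm = folner_sequenceD[OF folner, of m]
  define B where "B = F m \<inter> Q"
  have B: "finite B" "B \<subseteq> carrier G" "B \<subseteq> Q" using Fm by (auto simp: B_def)
  have cardB: "d * card (F m) \<le> card B" using m(1) Fm(4) by (simp add: B_def field_simps)
  obtain \<tau> v where \<tau>: "\<tau> \<in> (B \<rightarrow>\<^sub>E A) \<rightarrow> H k" and vA: "v \<in> UNIV \<rightarrow> A"
    and v: "\<And>y b. y \<in> B \<rightarrow>\<^sub>E A \<Longrightarrow> b \<in> B \<Longrightarrow> v (b \<otimes> \<tau> y) = y b"
    by (rule separated_patterns[OF B(1,2), of k]) (rule that)
  have \<tau>G: "\<tau> y \<in> carrier G" if "y \<in> B \<rightarrow>\<^sub>E A" for y using \<tau> that H_subset[of k] by auto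
  \<comment> \<open>The finitely many positions that must be decided in this stage.\<close>
  define Z where "Z = insert g ((\<lambda>(b, y). b \<otimes> \<tau> y) ` (B \<times> (B \<rightarrow>\<^sub>E A)))"
  have finZ: "finite Z" using B finite_A by (auto simp: Z_def intro!: finite_PiE)
  have ZG: "Z \<subseteq> carrier G" using g B \<tau>G by (auto simp: Z_def)
  have "\<forall>\<^sub>F k' in sequentially. ((\<forall>y\<in>Z. \<forall>z\<in>Z. H k' #> y = H k' #> z \<longrightarrow> y = z) \<and> k \<le> k')
      \<and> max (Suc n) (nat \<lceil>(card Z + 1) / (D - d)\<rceil>) \<le> card (rcosets (H k'))"
    by (intro eventually_conj eventually_separates finZ ZG eventually_index_ge eventually_ge_at_top)
  then obtain k' where sep: "\<And>y z. y \<in> Z \<Longrightarrow> z \<in> Z \<Longrightarrow> H k' #> y = H k' #> z \<Longrightarrow> y = z"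
    and kk': "k \<le> k'" and idx: "Suc n \<le> card (rcosets (H k'))"
    and idx': "nat \<lceil>(card Z + 1) / (D - d)\<rceil> \<le> card (rcosets (H k'))"
    unfolding eventually_sequentially max.bounded_iff by blast
  define R where "R = rcosets (H k')"
  define N where "N = card R"
  have N: "0 < N" "Suc n \<le> N" using idx by (auto simp: N_def R_def)
  have coset_in_R: "H k' #> u \<in> R" if "u \<in> carrier G" for u
    using that H_subset by (simp add: R_def rcosetsI)
  define \<Q> where "\<Q> = {C \<in> R. C \<subseteq> Q}"
  define \<Z> where "\<Z> = (\<lambda>z. H k' #> z) ` Z"
  have fin\<Q>: "finite \<Q>" using finite_index by (simp add: \<Q>_def R_def)
  have Q_k': "left_invariant_under G (H k') Q" "coset_density G (H k') Q = D"
    using coset_density_mono_level[OF folner Q kk'] by (auto simp: D_def)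
  have card\<Q>: "card \<Q> = D * N" 
    using Q_k'(2) N(1) by (auto simp: coset_density_def \<Q>_def N_def R_def field_simps)
  have room: "nat \<lfloor>d * N\<rfloor> + 1 \<le> card (\<Q> - \<Z>)"
  proof -
    have "(card Z + 1) / (D - d) \<le> N" using idx' by (simp add: N_def R_def) 
    then have "card Z + 1 \<le> (D - d) * N" using dD by (simp add: field_simps)
    moreover have "card \<Z> \<le> card Z" unfolding \<Z>_def using finZ by (rule card_image_le)
    moreover have "card \<Q> \<le> card (\<Q> - \<Z>) + card \<Z>"
    proof -
      have "card \<Q> \<le> card ((\<Q> - \<Z>) \<union> \<Z>)" 
        using fin\<Q> finZ by (intro card_mono) (auto simp: \<Z>_def)
      then show ?thesis by (rule order.trans[OF _ card_Un_le])
    qed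
    ultimately have "d * N + 1 \<le> card (\<Q> - \<Z>)" using card\<Q> by (simp add: algebra_simps)
    moreover have "real (nat \<lfloor>d * N\<rfloor>) \<le> d * N" using d_nonneg by simp
    ultimately have "real (nat \<lfloor>d * N\<rfloor> + 1) \<le> card (\<Q> - \<Z>)" by simp
    then show ?thesis by (simp only: of_nat_le_iff)
  qed
  obtain \<T> where \<T>: "\<T> \<subseteq> \<Q> - \<Z>" "card \<T> = nat \<lfloor>d * N\<rfloor> + 1"
    by (rule obtain_subset_with_card_n[OF room]) (rule that)
  define Q' where "Q' = \<Union>\<T>"
  have meet: "C = E" if "C \<in> R" "E \<in> R" "u \<in> C" "u \<in> E" for C E u
    using that by (intro rcosets_eq_if_meet[OF subgroup_H, of C k' E u]) (simp_all add: R_def)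
  have self: "u \<in> H k' #> u" if "u \<in> carrier G" for u by (rule rcos_self[OF that subgroup_H])
  have Q'_iff: "u \<in> Q' \<longleftrightarrow> H k' #> u \<in> \<T>" if u: "u \<in> carrier G" for u
  proof
    assume "u \<in> Q'"
    then obtain T where T: "T \<in> \<T>" "u \<in> T" by (auto simp: Q'_def)
    then have "T = H k' #> u" using meet[of T "H k' #> u" u] \<T>(1) coset_in_R[OF u] self[OF u] by (auto simp: \<Q>_def)
    with T show "H k' #> u \<in> \<T>" by simp
  next
    assume "H k' #> u \<in> \<T>" then show "u \<in> Q'" using self[OF u] by (auto simp: Q'_def)
  qed
  have Q'Q: "Q' \<subseteq> Q" using \<T>(1) by (auto simp: Q'_def \<Q>_def)
  have Z_notin: "z \<notin> Q'" if "z \<in> Z" for z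
    using Q'_iff[of z] that ZG \<T>(1) by (auto simp: \<Z>_def)
  have Q'_inv: "left_invariant_under G (H k') Q'"
    unfolding left_invariant_under_def
  proof (intro conjI ballI)
    fix h q assume hq: "h \<in> H k'" "q \<in> Q'"
    then have "q \<in> carrier G" "h \<in> carrier G" using Q'Q QG H_subset[of k'] by auto
    then show "h \<otimes> q \<in> Q'" using hq Q'_iff[of q] Q'_iff[of "h \<otimes> q"] rcoset_r_mult[OF hq(1)] by simp
  qed (use Q'Q QG in auto)
  have dens_Q': "coset_density G (H k') Q' = card \<T> / N"
  proof -
    have "{C \<in> R. C \<subseteq> Q'} = \<T>"
    proof (intro equalityI subsetI)
      fix C assume "C \<in> {C \<in> R. C \<subseteq> Q'}"
      then have C: "C \<in> R" "C \<subseteq> Q'" by auto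
      then obtain u where u: "u \<in> carrier G" "C = H k' #> u" by (auto simp: R_def RCOSETS_def)
      then have "u \<in> Q'" using C(2) self by auto
      then show "C \<in> \<T>" using Q'_iff[OF u(1)] u(2) by simp
    next
      fix C assume "C \<in> \<T>" then show "C \<in> {C \<in> R. C \<subseteq> Q'}" using \<T>(1) by (auto simp: \<Q>_def Q'_def)
    qed
    then show ?thesis by (simp add: coset_density_def R_def N_def)
  qed
  have floor_d: "real (card \<T>) = \<lfloor>d * N\<rfloor> + 1" using \<T>(2) d_nonneg by simp
  \<comment> \<open>The representative in \<open>Z\<close> of the coset of \<open>u\<close>; on holes whose coset does not meet \<open>Z\<close> it is
      arbitrary but still constant on cosets, so that \<open>x'\<close> below is periodic there as well.\<close>
  define pick where "pick u = (SOME z. z \<in> Z \<and> H k' #> u = H k' #> z)" for u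
  have pick: "pick z = z" if "z \<in> Z" for z
  proof -
    have "pick z \<in> Z \<and> H k' #> z = H k' #> pick z"
      unfolding pick_def by (rule someI[of _ z]) (use that in simp)
    then show ?thesis using sep[of z "pick z"] that by simp
  qed
  have pick_inv: "pick (\<gamma> \<otimes> u) = pick u" if "\<gamma> \<in> H k'" "u \<in> carrier G" for \<gamma> u
    by (simp add: pick_def rcoset_r_mult[OF that])
  define x' where "x' u = (if u \<in> Q then v (pick u) else x u)" for u
  show thesis
  proof (rule that)
    show "partial_toeplitz k' Q' x'"
      unfolding partial_toeplitz_def
    proof (intro conjI ballI Q'_inv)
      show "x' \<in> carrier G \<rightarrow> A" using vA xA by (auto simp: x'_def Pi_iff)
      fix \<gamma> u assume \<gamma>: "\<gamma> \<in> H k'" and u: "u \<in> carrier G - Q'"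
      have \<gamma>k: "\<gamma> \<in> H k" "\<gamma> \<in> carrier G" using \<gamma> H_antimono[OF kk'] H_subset[of k'] by auto
      have "\<gamma> \<otimes> u \<in> Q \<longleftrightarrow> u \<in> Q"
      proof
        assume "\<gamma> \<otimes> u \<in> Q"
        moreover have "inv \<gamma> \<in> H k" using \<gamma>k subgroup_H by (simp add: subgroup.m_inv_closed)
        ultimately have "inv \<gamma> \<otimes> (\<gamma> \<otimes> u) \<in> Q" using Q by (auto simp: left_invariant_under_def)
        then show "u \<in> Q" using \<gamma>k u by (simp add: m_assoc[symmetric])
      qed (use Q \<gamma>k in \<open>auto simp: left_invariant_under_def\<close>)
      then show "x' (\<gamma> \<otimes> u) = x' u" using \<gamma> \<gamma>k u pick_inv xinv by (simp add: x'_def)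
    qed
    have "d * N < \<lfloor>d * N\<rfloor> + 1" by linarith
    then show "d < coset_density G (H k') Q'" 
      using N(1) unfolding dens_Q' floor_d by (simp add: field_simps)
    have "(\<lfloor>d * N\<rfloor> + 1) / N \<le> (d * N + 1) / N" by (intro divide_right_mono) auto
    also have "\<dots> = d + 1 / N" using N(1) by (simp add: field_simps)
    also have "\<dots> \<le> d + 1 / Suc n" using N by (intro add_left_mono divide_left_mono) auto
    finally show "coset_density G (H k') Q' \<le> d + 1 / Suc n" unfolding dens_Q' floor_d by simp
    show "Q' \<subseteq> Q" by (rule Q'Q)
    show "g \<notin> Q'" using Z_notin by (auto simp: Z_def)
    show "x' u = x u" if "u \<in> carrier G - Q" for u using that by (simp add: x'_def)
    show "n \<le> m" by (rule m(2))
    show "B \<subseteq> F m" by (auto simp: B_def)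
    show "d * card (F m) \<le> card B" by (rule cardB)
    show "\<exists>\<gamma>\<in>carrier G. \<forall>b\<in>B. b \<otimes> \<gamma> \<notin> Q' \<and> x' (b \<otimes> \<gamma>) = y b" if y: "y \<in> B \<rightarrow>\<^sub>E A" for y
    proof (intro bexI[of _ "\<tau> y"] ballI conjI \<tau>G y)
      fix b assume b: "b \<in> B"
      have Z: "b \<otimes> \<tau> y \<in> Z" using b y by (auto simp: Z_def)
      then show "b \<otimes> \<tau> y \<notin> Q'" by (rule Z_notin)
      have "b \<otimes> \<tau> y \<in> Q"
      proof -
        have bG: "b \<in> carrier G" using b B by auto
        have "b \<otimes> \<tau> y \<otimes> inv b \<in> H k"
          using \<tau> y normal.inv_op_closed2[OF normal bG] by blast
        then have "(b \<otimes> \<tau> y \<otimes> inv b) \<otimes> b \<in> Q"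
          using Q b B(3) by (auto simp: left_invariant_under_def)
        then show ?thesis using bG \<tau>G[OF y] by (simp add: m_assoc)
      qed
      then show "x' (b \<otimes> \<tau> y) = y b" using pick[OF Z] v[OF y b] by (simp add: x'_def)
    qed
  qed
qed

text \<open>The limit of the stages. Each position is decided at some stage and never changed afterwards,
  so it inherits the period of that stage.\<close>

theorem toeplitz_with_hole_density:
  assumes "d < 1" and cnt: "countable (carrier G)"
  obtains \<eta> where "toeplitz G A \<eta>"
    "\<And>e. 0 < e \<Longrightarrow> \<exists>k Q. left_invariant_under G (H k) Q \<and> coset_density G (H k) Q < d + e \<and>
       (\<forall>\<gamma>\<in>H k. \<forall>g\<in>carrier G - Q. \<eta> (\<gamma> \<otimes> g) = \<eta> g)"
    "\<And>n. \<exists>m\<ge>n. \<exists>B\<subseteq>F m. d * card (F m) \<le> card B \<and>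
       (\<forall>y\<in>B \<rightarrow>\<^sub>E A. \<exists>\<gamma>\<in>carrier G. \<forall>b\<in>B. \<eta> (b \<otimes> \<gamma>) = y b)"
proof -
  define en where "en = from_nat_into (carrier G)"
  have en: "range en = carrier G" unfolding en_def using cnt by (intro range_from_nat_into) auto
  obtain a0 where a0: "a0 \<in> A" using A_nonempty by auto
  define P where "P = (\<lambda>(n::nat) (k, Q, x). partial_toeplitz k Q x \<and> d < coset_density G (H k) Q)"
  define rel where "rel = (\<lambda>n (k::nat, Q, x) (k', Q', x'). coset_density G (H k') Q' \<le> d + 1 / Suc n \<and>
    Q' \<subseteq> Q \<and> en n \<notin> Q' \<and> (\<forall>u\<in>carrier G - Q. x' u = x u) \<and>
    (\<exists>m\<ge>n. \<exists>B\<subseteq>F m. d * card (F m) \<le> card B \<and>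
       (\<forall>y\<in>B \<rightarrow>\<^sub>E A. \<exists>\<gamma>\<in>carrier G. \<forall>b\<in>B. b \<otimes> \<gamma> \<notin> Q' \<and> x' (b \<otimes> \<gamma>) = y b)))"
  have "\<exists>f. \<forall>n. P n (f n) \<and> rel n (f n) (f (Suc n))"
  proof (rule dependent_nat_choice)
    have "partial_toeplitz 0 (carrier G) (\<lambda>_. a0)"
      using H_subset[of 0] a0 by (auto simp: partial_toeplitz_def left_invariant_under_def)
    moreover have "coset_density G (H 0) (carrier G) = 1"
    proof -
      have "{C \<in> rcosets H 0. C \<subseteq> carrier G} = rcosets H 0"
        using rcosets_part_G[OF subgroup_H] by blast
      moreover have "rcosets H 0 \<noteq> {}" using rcosets_part_G[OF subgroup_H, of 0] by auto
      ultimately show ?thesis using finite_index by (simp add: coset_density_def)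
    qed
    ultimately show "\<exists>s. P 0 s" using assms(1)
      by (intro exI[of _ "(0, carrier G, \<lambda>_. a0)"]) (simp add: P_def)
  next
    fix s n assume "P n s"
    moreover obtain k Q x where s: "s = (k, Q, x)" by (cases s)
    ultimately have "partial_toeplitz k Q x" "d < coset_density G (H k) Q" by (auto simp: P_def)
    moreover have "en n \<in> carrier G" using en by auto
    ultimately obtain k' Q' x' B m where
      "partial_toeplitz k' Q' x'" "d < coset_density G (H k') Q'" "coset_density G (H k') Q' \<le> d + 1 / Suc n"
      "Q' \<subseteq> Q" "en n \<notin> Q'" "\<And>u. u \<in> carrier G - Q \<Longrightarrow> x' u = x u"
      "n \<le> m" "B \<subseteq> F m" "d * card (F m) \<le> card B"
      "\<And>y. y \<in> B \<rightarrow>\<^sub>E A \<Longrightarrow> \<exists>\<gamma>\<in>carrier G. \<forall>b\<in>B. b \<otimes> \<gamma> \<notin> Q' \<and> x' (b \<otimes> \<gamma>) = y b"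
      by (rule partial_toeplitz_extend[where n = n]) (rule that)
    then have "P (Suc n) (k', Q', x') \<and> rel n s (k', Q', x')"
      unfolding P_def rel_def s prod.case by blast
    then show "\<exists>s'. P (Suc n) s' \<and> rel n s s'" by blast
  qed
  then obtain f where f: "\<And>n. P n (f n)" "\<And>n. rel n (f n) (f (Suc n))" by blast
  define k Q x where "k n = fst (f n)" and "Q n = fst (snd (f n))" and "x n = snd (snd (f n))" for n
  have f_eq: "f n = (k n, Q n, x n)" for n by (simp add: k_def Q_def x_def)
  have pt: "partial_toeplitz (k n) (Q n) (x n)" for n using f(1)[of n] by (simp add: P_def f_eq)
  have stage_step: "coset_density G (H (k (Suc n))) (Q (Suc n)) \<le> d + 1 / Suc n" "Q (Suc n) \<subseteq> Q n" "en n \<notin> Q (Suc n)"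
    "\<And>u. u \<in> carrier G - Q n \<Longrightarrow> x (Suc n) u = x n u"
    and patterns: "\<exists>m\<ge>n. \<exists>B\<subseteq>F m. d * card (F m) \<le> card B \<and>
       (\<forall>y\<in>B \<rightarrow>\<^sub>E A. \<exists>\<gamma>\<in>carrier G. \<forall>b\<in>B. b \<otimes> \<gamma> \<notin> Q (Suc n) \<and> x (Suc n) (b \<otimes> \<gamma>) = y b)" for n
    using f(2)[of n] by (simp_all add: rel_def f_eq)
  have Q_anti: "Q n' \<subseteq> Q n" if "n \<le> n'" for n n'
    using stage_step(2) that by (rule lift_Suc_antimono_le)
  have x_stable: "x n' u = x n u" if "n \<le> n'" "u \<in> carrier G - Q n" for n n' u
    using that(1)
  proof (induction n' rule: dec_induct)
    case (step n')
    then show ?case using stage_step(4)[of u n'] that(2) Q_anti[of n n'] by auto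
  qed simp
  have decided: "\<exists>n. u \<notin> Q n" if "u \<in> carrier G" for u
    using en that stage_step(3) by (metis rangeE)
  define \<eta> where "\<eta> = (\<lambda>u\<in>carrier G. x (LEAST n. u \<notin> Q n) u)"
  have \<eta>: "\<eta> u = x n u" if "u \<in> carrier G" "u \<notin> Q n" for u n
  proof -
    have "(LEAST n. u \<notin> Q n) \<le> n" using that(2) by (rule Least_le)
    moreover have "u \<notin> Q (LEAST n. u \<notin> Q n)" using that(2) by (rule LeastI)
    ultimately show ?thesis using x_stable[of "LEAST n. u \<notin> Q n" n u] that(1) by (simp add: \<eta>_def)
  qed
  have invQ: "left_invariant_under G (H (k n)) (Q n)" for n using pt by (simp add: partial_toeplitz_def)
  have \<eta>_inv: "\<eta> (\<gamma> \<otimes> u) = \<eta> u" if \<gamma>: "\<gamma> \<in> H (k n)" and u: "u \<in> carrier G - Q n" for \<gamma> u n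
  proof -
    have \<gamma>G: "\<gamma> \<in> carrier G" using \<gamma> H_subset by auto
    have "\<gamma> \<otimes> u \<notin> Q n"
    proof
      assume "\<gamma> \<otimes> u \<in> Q n"
      moreover have "inv \<gamma> \<in> H (k n)" using \<gamma> subgroup_H by (simp add: subgroup.m_inv_closed)
      ultimately have "inv \<gamma> \<otimes> (\<gamma> \<otimes> u) \<in> Q n" using invQ by (auto simp: left_invariant_under_def)
      then show False using u \<gamma>G by (simp add: m_assoc[symmetric])
    qed
    then have "\<eta> (\<gamma> \<otimes> u) = x n (\<gamma> \<otimes> u)" using \<eta> \<gamma>G u by simp
    also have "\<dots> = x n u" using pt[of n] \<gamma> u by (simp add: partial_toeplitz_def)
    finally show ?thesis using \<eta>[of u n] u by simp
  qed
  show thesis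
  proof (rule that)
    show "toeplitz G A \<eta>"
      unfolding toeplitz_def
    proof (intro conjI ballI)
      show "\<eta> \<in> configurations G A"
        using pt by (auto simp: configurations_def \<eta>_def partial_toeplitz_def)
      fix g assume g: "g \<in> carrier G"
      then obtain n where "g \<notin> Q n" using decided by blast
      then show "\<exists>K. subgroup K G \<and> finite (rcosets K) \<and> (\<forall>\<gamma>\<in>K. \<eta> (\<gamma> \<otimes> g) = \<eta> g)"
        using g \<eta>_inv subgroup_H finite_index by (intro exI[of _ "H (k n)"]) auto
    qed
    show "\<exists>k Q. left_invariant_under G (H k) Q \<and> coset_density G (H k) Q < d + e \<and>
       (\<forall>\<gamma>\<in>H k. \<forall>g\<in>carrier G - Q. \<eta> (\<gamma> \<otimes> g) = \<eta> g)" if e: "0 < e" for e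
    proof -
      obtain n where "1 / Suc n < e" using nat_approx_posE[OF e] by blast
      then have "coset_density G (H (k (Suc n))) (Q (Suc n)) < d + e" using stage_step(1)[of n] by simp
      then show ?thesis using invQ \<eta>_inv by blast
    qed
    show "\<exists>m\<ge>n. \<exists>B\<subseteq>F m. d * card (F m) \<le> card B \<and>
       (\<forall>y\<in>B \<rightarrow>\<^sub>E A. \<exists>\<gamma>\<in>carrier G. \<forall>b\<in>B. \<eta> (b \<otimes> \<gamma>) = y b)" for n
    proof -
      obtain m B where mB: "n \<le> m" "B \<subseteq> F m" "d * card (F m) \<le> card B"
        and y: "\<forall>y\<in>B \<rightarrow>\<^sub>E A. \<exists>\<gamma>\<in>carrier G. \<forall>b\<in>B. b \<otimes> \<gamma> \<notin> Q (Suc n) \<and> x (Suc n) (b \<otimes> \<gamma>) = y b"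
        using patterns[of n] by (elim exE conjE)
      have BG: "B \<subseteq> carrier G" by (rule order.trans[OF mB(2) folner_sequenceD(3)[OF folner]])
      have "\<exists>\<gamma>\<in>carrier G. \<forall>b\<in>B. \<eta> (b \<otimes> \<gamma>) = y b" if y_in: "y \<in> B \<rightarrow>\<^sub>E A" for y
      proof -
        obtain \<gamma> where \<gamma>: "\<gamma> \<in> carrier G"
          "\<forall>b\<in>B. b \<otimes> \<gamma> \<notin> Q (Suc n) \<and> x (Suc n) (b \<otimes> \<gamma>) = y b"
          using bspec[OF y y_in] by (elim bexE)
        have "\<eta> (b \<otimes> \<gamma>) = y b" if "b \<in> B" for b
          using \<gamma> that \<eta>[of "b \<otimes> \<gamma>" "Suc n"] subsetD[OF BG that] by simp
        with \<gamma>(1) show ?thesis by (intro bexI[of _ \<gamma>] ballI)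
      qed
      with mB show ?thesis by (intro exI[of _ m] exI[of _ B] conjI ballI)
    qed
  qed
qed

end

section \<open>Patterns and covers of an orbit closure\<close>

text \<open>A finite cover finer than \<open>\<U>\<close> bounds the size of a subcover of \<open>\<U>\<close>. All upper estimates of
  subcover numbers below arise in this way.\<close>

lemma ex_subcover_refined:
  assumes "finite \<V>" "\<Union>\<V> = topspace Y" "\<And>V. V \<in> \<V> \<Longrightarrow> \<exists>U\<in>\<U>. V \<subseteq> U" "\<And>U. U \<in> \<U> \<Longrightarrow> U \<subseteq> topspace Y"
  shows "\<exists>\<W>\<subseteq>\<U>. finite \<W> \<and> \<Union>\<W> = topspace Y \<and> card \<W> \<le> card \<V>"
proof -
  obtain f where f: "\<And>V. V \<in> \<V> \<Longrightarrow> f V \<in> \<U> \<and> V \<subseteq> f V" using assms(3) by metis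
  have "\<Union>(f ` \<V>) = topspace Y"
  proof
    show "\<Union>(f ` \<V>) \<subseteq> topspace Y" using f assms(4) by blast
    show "topspace Y \<subseteq> \<Union>(f ` \<V>)" using f assms(2) by blast
  qed
  then show ?thesis using f assms(1) by (intro exI[of _ "f ` \<V>"]) (auto simp: card_image_le)
qed

lemma subcover_number_le:
  assumes "finite \<V>" "\<Union>\<V> = topspace Y" "\<And>V. V \<in> \<V> \<Longrightarrow> \<exists>U\<in>\<U>. V \<subseteq> U" "\<And>U. U \<in> \<U> \<Longrightarrow> U \<subseteq> topspace Y"
  shows "subcover_number Y \<U> \<le> card \<V>"
proof -
  obtain \<W> where \<W>: "\<W> \<subseteq> \<U>" "finite \<W>" "\<Union>\<W> = topspace Y" "card \<W> \<le> card \<V>"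
    using ex_subcover_refined[of \<V> Y \<U>] assms by blast
  then have "subcover_number Y \<U> \<le> card \<W>"
    unfolding subcover_number_def by (intro Least_le) blast
  with \<W>(4) show ?thesis by simp
qed

lemma minimal_subcover:
  assumes "\<V> \<subseteq> \<U>" "finite \<V>" "\<Union>\<V> = topspace Y"
  obtains \<W> where "\<W> \<subseteq> \<U>" "finite \<W>" "\<Union>\<W> = topspace Y" "card \<W> = subcover_number Y \<U>"
proof -
  have "\<exists>n. \<exists>\<W>. \<W> \<subseteq> \<U> \<and> finite \<W> \<and> \<Union>\<W> = topspace Y \<and> card \<W> = n" using assms by blast
  from LeastI_ex[OF this] show thesis using that unfolding subcover_number_def by blast
qed

lemma refined_cover_subset: "U \<in> refined_cover Y act \<U> F \<Longrightarrow> U \<subseteq> topspace Y"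
  by (auto simp: refined_cover_def)

text \<open>The value at \<open>s\<close> is read at \<open>s \<gamma>\<close>, so these are the restrictions to \<open>S\<close> of the points of the
  orbit of \<open>x\<close> under the shift.\<close>

definition patterns :: "('g, 'm) monoid_scheme \<Rightarrow> ('g \<Rightarrow> 'a) \<Rightarrow> 'g set \<Rightarrow> ('g \<Rightarrow> 'a) set" where
  "patterns G x S = (\<lambda>\<gamma>. \<lambda>s\<in>S. x (s \<otimes>\<^bsub>G\<^esub> \<gamma>)) ` carrier G"

locale orbit_system = group G for G :: "('g, 'm) monoid_scheme" (structure) +
  fixes A :: "'a set" and \<eta> :: "'g \<Rightarrow> 'a"
  assumes finite_A: "finite A" and config: "\<eta> \<in> configurations G A"
begin

abbreviation "X \<equiv> orbit_closure G A \<eta>"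
abbreviation "Y \<equiv> subtopology (configuration_topology G A) X"

lemma topspace_conf: "topspace (configuration_topology G A) = configurations G A"
  by (simp add: configuration_topology_def configurations_def)

lemma X_subset: "X \<subseteq> configurations G A"
  unfolding orbit_closure_def using closure_of_subset_topspace topspace_conf by metis

lemma topspace_Y: "topspace Y = X"
  using X_subset topspace_conf by auto

lemma shift_conf: "c \<in> carrier G \<Longrightarrow> x \<in> configurations G A \<Longrightarrow> shift G c x \<in> configurations G A"
  by (auto simp: shift_def configurations_def)

lemma openin_cylinder:
  assumes "finite S" "S \<subseteq> carrier G"
  shows "openin (configuration_topology G A) {x \<in> configurations G A. \<forall>s\<in>S. x s = p s}"
proof -
  have "{x \<in> configurations G A. \<forall>s\<in>S. x s = p s} = (\<Pi>\<^sub>E g\<in>carrier G. if g \<in> S then A \<inter> {p g} else A)"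
    using assms(2) by (auto simp: configurations_def PiE_iff extensional_def split: if_splits)
  moreover have "finite {g \<in> carrier G. (if g \<in> S then A \<inter> {p g} else A) \<noteq> A}"
    by (rule finite_subset[OF _ assms(1)]) auto
  ultimately show ?thesis
    unfolding configuration_topology_def by (simp add: openin_PiE_gen)
qed

text \<open>Approximation in the product topology is agreement on finite sets.\<close>

lemma mem_orbit_closure_iff:
  "x \<in> X \<longleftrightarrow> x \<in> configurations G A \<and>
     (\<forall>S. finite S \<and> S \<subseteq> carrier G \<longrightarrow> (\<exists>\<gamma>\<in>carrier G. \<forall>s\<in>S. x s = \<eta> (s \<otimes> \<gamma>)))"
  (is "_ \<longleftrightarrow> _ \<and> ?R")
proof (intro iffI conjI allI impI; (elim conjE)?)
  assume x: "x \<in> X"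
  then show "x \<in> configurations G A" using X_subset by auto
  fix S assume S: "finite S" "S \<subseteq> carrier G"
  define T where "T = {y \<in> configurations G A. \<forall>s\<in>S. y s = x s}"
  have T: "x \<in> T" "openin (configuration_topology G A) T"
    using x X_subset openin_cylinder[OF S, of x] by (auto simp: T_def)
  have "\<forall>T. x \<in> T \<and> openin (configuration_topology G A) T \<longrightarrow> (\<exists>y. y \<in> (\<lambda>\<gamma>. shift G \<gamma> \<eta>) ` carrier G \<and> y \<in> T)"
    using x unfolding orbit_closure_def in_closure_of by (rule conjunct2)
  then obtain \<gamma> where "\<gamma> \<in> carrier G" "shift G \<gamma> \<eta> \<in> T" using T by blast
  then show "\<exists>\<gamma>\<in>carrier G. \<forall>s\<in>S. x s = \<eta> (s \<otimes> \<gamma>)"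
    using S(2) by (intro bexI[of _ \<gamma>]) (auto simp: T_def shift_def subset_iff)
next
  assume x: "x \<in> configurations G A" and R: ?R
  show "x \<in> X"
    unfolding orbit_closure_def in_closure_of topspace_conf
  proof (intro conjI x allI impI; elim conjE)
    fix T assume T: "x \<in> T" "openin (configuration_topology G A) T"
    then obtain V where V: "finite {g \<in> carrier G. V g \<noteq> A}" "x \<in> PiE (carrier G) V" "PiE (carrier G) V \<subseteq> T"
      unfolding configuration_topology_def openin_product_topology_alt by force
    then obtain \<gamma> where \<gamma>: "\<gamma> \<in> carrier G" "\<And>g. g \<in> carrier G \<Longrightarrow> V g \<noteq> A \<Longrightarrow> x g = \<eta> (g \<otimes> \<gamma>)"
      using R[rule_format, of "{g \<in> carrier G. V g \<noteq> A}"] by auto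
    have "shift G \<gamma> \<eta> \<in> PiE (carrier G) V"
    proof (rule PiE_I)
      fix g assume g: "g \<in> carrier G"
      have "shift G \<gamma> \<eta> g \<in> A" using shift_conf[OF \<gamma>(1) config] g by (auto simp: configurations_def)
      moreover have "shift G \<gamma> \<eta> g = x g" if "V g \<noteq> A" using \<gamma>(2)[OF g that] g by (simp add: shift_def)
      moreover have "x g \<in> V g" using V(2) g by auto
      ultimately show "shift G \<gamma> \<eta> g \<in> V g" by metis
    qed (simp add: shift_def)
    then show "\<exists>y. y \<in> (\<lambda>\<gamma>. shift G \<gamma> \<eta>) ` carrier G \<and> y \<in> T" using \<gamma>(1) V(3) by blast
  qed
qed

lemma shift_orbit_in_X: "\<gamma> \<in> carrier G \<Longrightarrow> shift G \<gamma> \<eta> \<in> X"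
  using shift_conf[OF _ config] by (auto simp: mem_orbit_closure_iff shift_def subset_iff intro!: bexI[of _ \<gamma>])

lemma X_nonempty: "X \<noteq> {}"
  using shift_orbit_in_X[OF one_closed] by auto

lemma shift_X: 
  assumes "c \<in> carrier G" "x \<in> X"
  shows "shift G c x \<in> X"
  unfolding mem_orbit_closure_iff
proof (intro conjI allI impI; (elim conjE)?)
  show "shift G c x \<in> configurations G A" using assms shift_conf X_subset by auto
  fix S assume S: "finite S" "S \<subseteq> carrier G"
  have "finite ((\<lambda>s. s \<otimes> c) ` S)" "(\<lambda>s. s \<otimes> c) ` S \<subseteq> carrier G" using S assms by auto
  then obtain \<gamma> where \<gamma>: "\<gamma> \<in> carrier G" "\<And>s. s \<in> S \<Longrightarrow> x (s \<otimes> c) = \<eta> (s \<otimes> c \<otimes> \<gamma>)"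
    using assms(2) unfolding mem_orbit_closure_iff by (metis imageI)
  then show "\<exists>\<gamma>\<in>carrier G. \<forall>s\<in>S. shift G c x s = \<eta> (s \<otimes> \<gamma>)"
    using S(2) assms(1) by (intro bexI[of _ "c \<otimes> \<gamma>"]) (auto simp: shift_def m_assoc subset_iff)
qed

lemma compact_Y: "compact_space Y"
proof -
  have "compact_space (configuration_topology G A)"
    using finite_A by (simp add: configuration_topology_def compact_space_product_topology compact_space_discrete_topology)
  then show ?thesis
    by (intro compact_space_subtopology closedin_compact_space) (simp_all add: orbit_closure_def)
qed

text \<open>The analogue of the Lebesgue number: by compactness there is one finite window \<open>S\<close> such that the
  symbols in \<open>S\<close> decide on a member of the cover.\<close>

lemma open_cover_window:
  assumes \<U>: "open_cover Y \<U>"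
  obtains S where "finite S" "S \<subseteq> carrier G"
    "\<And>x. x \<in> X \<Longrightarrow> \<exists>U\<in>\<U>. \<forall>y\<in>X. (\<forall>s\<in>S. y s = x s) \<longrightarrow> y \<in> U"
proof -
  have "\<exists>S. \<exists>U\<in>\<U>. finite S \<and> S \<subseteq> carrier G \<and> (\<forall>y\<in>X. (\<forall>s\<in>S. y s = x s) \<longrightarrow> y \<in> U)" if x: "x \<in> X" for x
  proof -
    have "x \<in> \<Union>\<U>" using \<U> x topspace_Y by (simp add: open_cover_def)
    then obtain U where U: "U \<in> \<U>" "x \<in> U" by blast
    then have "openin Y U" using \<U> by (auto simp: open_cover_def)
    then obtain T where T: "openin (configuration_topology G A) T" "U = T \<inter> X"
      by (auto simp: openin_subtopology)
    then obtain V where V: "finite {g \<in> carrier G. V g \<noteq> A}" "x \<in> PiE (carrier G) V" "PiE (carrier G) V \<subseteq> T"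
      using U(2) unfolding configuration_topology_def openin_product_topology_alt by force
    have "y \<in> U" if y: "y \<in> X" and eq: "\<forall>g\<in>{g \<in> carrier G. V g \<noteq> A}. y g = x g" for y
    proof -
      have yc: "y \<in> carrier G \<rightarrow>\<^sub>E A" using y X_subset by (auto simp: configurations_def)
      have "y \<in> PiE (carrier G) V"
      proof (rule PiE_I)
        fix g assume g: "g \<in> carrier G"
        show "y g \<in> V g" using eq yc V(2) g by (cases "V g = A") (auto simp: PiE_iff)
      next
        fix g assume "g \<notin> carrier G" then show "y g = undefined" using yc by (auto simp: PiE_iff extensional_def)
      qed
      then show ?thesis using V(3) T(2) y by auto
    qed
    then show ?thesis using U(1) V(1) by (intro exI[of _ "{g \<in> carrier G. V g \<noteq> A}"] bexI[of _ U]) auto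
  qed
  then obtain S U where SU: "\<And>x. x \<in> X \<Longrightarrow> U x \<in> \<U> \<and> finite (S x) \<and> S x \<subseteq> carrier G \<and>
      (\<forall>y\<in>X. (\<forall>s\<in>S x. y s = x s) \<longrightarrow> y \<in> U x)" by metis
  define cyl where "cyl x = {y \<in> configurations G A. \<forall>s\<in>S x. y s = x s} \<inter> X" for x
  have "openin Y (cyl x)" if "x \<in> X" for x
    unfolding cyl_def using SU[OF that] by (intro openin_subtopology_Int openin_cylinder) auto
  then have "Ball (cyl ` X) (openin Y)" by auto
  moreover have "topspace Y \<subseteq> \<Union>(cyl ` X)"
    unfolding topspace_Y using X_subset by (auto simp: cyl_def)
  ultimately have "\<exists>\<F>. finite \<F> \<and> \<F> \<subseteq> cyl ` X \<and> topspace Y \<subseteq> \<Union>\<F>"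
    using compact_Y unfolding compact_space_alt by (elim allE[of _ "cyl ` X"] impE) (rule conjI)
  then obtain \<F> where \<F>: "finite \<F>" "\<F> \<subseteq> cyl ` X" "topspace Y \<subseteq> \<Union>\<F>" by (elim exE conjE)
  then obtain K where K: "finite K" "K \<subseteq> X" "\<F> = cyl ` K" by (meson finite_subset_image)
  show thesis
  proof (rule that[of "\<Union>z\<in>K. S z"])
    show "finite (\<Union>z\<in>K. S z)" "(\<Union>z\<in>K. S z) \<subseteq> carrier G" using K SU by auto
    fix x assume x: "x \<in> X"
    then obtain z where z: "z \<in> K" "x \<in> cyl z" using \<F>(3) K(3) topspace_Y by auto
    have "y \<in> U z" if "y \<in> X" "\<forall>s\<in>(\<Union>z\<in>K. S z). y s = x s" for y
      using SU[of z] z K(2) that by (auto simp: cyl_def)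
    then show "\<exists>U\<in>\<U>. \<forall>y\<in>X. (\<forall>s\<in>(\<Union>z\<in>K. S z). y s = x s) \<longrightarrow> y \<in> U"
      using SU[of z] z K(2) by (intro bexI[of _ "U z"]) auto
  qed
qed

lemma patterns_subset:
  assumes "S \<subseteq> carrier G"
  shows "patterns G \<eta> S \<subseteq> S \<rightarrow>\<^sub>E A"
  using assms config by (auto simp: patterns_def configurations_def PiE_iff subset_iff)

lemma finite_patterns: "finite S \<Longrightarrow> S \<subseteq> carrier G \<Longrightarrow> finite (patterns G \<eta> S)"
  using finite_subset[OF patterns_subset finite_PiE] finite_A by blast

text \<open>The symbols of \<open>y\<close> on \<open>S F\<close> determine those of each \<open>f y\<close>, \<open>f \<in> F\<close>, on the window \<open>S\<close>. Hence the
  partition by the patterns on \<open>S F\<close> is finer than the refined cover.\<close>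

lemma refined_cover_patterns:
  assumes S: "finite S" "S \<subseteq> carrier G"
    and window: "\<And>x. x \<in> X \<Longrightarrow> \<exists>U\<in>\<U>. \<forall>y\<in>X. (\<forall>s\<in>S. y s = x s) \<longrightarrow> y \<in> U"
    and F: "finite F" "F \<subseteq> carrier G"
  shows "\<exists>\<W>\<subseteq>refined_cover Y (shift G) \<U> F. finite \<W> \<and> \<Union>\<W> = topspace Y"
    and "subcover_number Y (refined_cover Y (shift G) \<U> F) \<le> card (patterns G \<eta> (\<Union>s\<in>S. s <# F))"
proof -
  define T where "T = (\<Union>s\<in>S. s <# F)"
  have T: "finite T" "T \<subseteq> carrier G" using S F by (auto simp: T_def l_coset_def)
  define cell where "cell p = {y \<in> X. \<forall>t\<in>T. y t = p t}" for p
  define \<V> where "\<V> = cell ` patterns G \<eta> T"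
  have \<V>: "finite \<V>" using finite_patterns[OF T] by (simp add: \<V>_def)
  have cover: "\<Union>\<V> = topspace Y"
    unfolding topspace_Y
  proof (intro equalityI subsetI)
    fix y assume y: "y \<in> X"
    then obtain \<gamma> where \<gamma>: "\<gamma> \<in> carrier G" "\<And>t. t \<in> T \<Longrightarrow> y t = \<eta> (t \<otimes> \<gamma>)"
      using T unfolding mem_orbit_closure_iff by metis
    then have "y \<in> cell (\<lambda>t\<in>T. \<eta> (t \<otimes> \<gamma>))" using y by (simp add: cell_def)
    then show "y \<in> \<Union>\<V>" using \<gamma>(1) by (auto simp: \<V>_def patterns_def)
  qed (auto simp: \<V>_def cell_def)
  have refines: "\<exists>U\<in>refined_cover Y (shift G) \<U> F. V \<subseteq> U" if V: "V \<in> \<V>" for V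
  proof -
    obtain \<gamma> where \<gamma>: "\<gamma> \<in> carrier G" "V = cell (\<lambda>t\<in>T. \<eta> (t \<otimes> \<gamma>))"
      using V by (auto simp: \<V>_def patterns_def)
    define y0 where "y0 = shift G \<gamma> \<eta>"
    have y0: "y0 \<in> X" using shift_orbit_in_X \<gamma>(1) by (simp add: y0_def)
    have "\<forall>f\<in>F. \<exists>U\<in>\<U>. \<forall>y\<in>X. (\<forall>s\<in>S. y s = shift G f y0 s) \<longrightarrow> y \<in> U"
      using window[OF shift_X[OF _ y0]] F(2) by blast
    then obtain W where W: "\<And>f. f \<in> F \<Longrightarrow> W f \<in> \<U>"
        "\<And>f y. f \<in> F \<Longrightarrow> y \<in> X \<Longrightarrow> (\<forall>s\<in>S. y s = shift G f y0 s) \<Longrightarrow> y \<in> W f" by metis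
    have "V \<subseteq> {y \<in> topspace Y. \<forall>f\<in>F. shift G f y \<in> W f}"
      unfolding topspace_Y
    proof (intro subsetI CollectI conjI ballI)
      fix y assume "y \<in> V"
      then have y: "y \<in> X" "\<And>t. t \<in> T \<Longrightarrow> y t = \<eta> (t \<otimes> \<gamma>)" by (auto simp: \<gamma>(2) cell_def)
      show "y \<in> X" by (rule y)
      fix f assume f: "f \<in> F"
      show "shift G f y \<in> W f"
      proof (rule W(2)[OF f shift_X[OF _ y(1)]])
        show "f \<in> carrier G" using f F by auto
        show "\<forall>s\<in>S. shift G f y s = shift G f y0 s"
        proof
          fix s assume s: "s \<in> S"
          then have "s \<otimes> f \<in> T" using f by (auto simp: T_def l_coset_def)
          then show "shift G f y s = shift G f y0 s"
            using s f S F y(2)[of "s \<otimes> f"] by (auto simp: shift_def y0_def)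
        qed
      qed
    qed
    moreover have "W \<in> F \<rightarrow> \<U>" using W(1) by auto
    ultimately show ?thesis unfolding refined_cover_def by blast
  qed
  show "\<exists>\<W>\<subseteq>refined_cover Y (shift G) \<U> F. finite \<W> \<and> \<Union>\<W> = topspace Y"
  proof -
    have "\<exists>\<W>\<subseteq>refined_cover Y (shift G) \<U> F. finite \<W> \<and> \<Union>\<W> = topspace Y \<and> card \<W> \<le> card \<V>"
      by (rule ex_subcover_refined[OF \<V> cover]) (erule refines, erule refined_cover_subset)
    then show ?thesis by (elim exE conjE) (intro exI conjI)
  qed
  have "subcover_number Y (refined_cover Y (shift G) \<U> F) \<le> card \<V>"
    by (rule subcover_number_le[OF \<V> cover]) (erule refines, erule refined_cover_subset)
  also have "\<dots> \<le> card (patterns G \<eta> T)" unfolding \<V>_def by (rule card_image_le[OF finite_patterns[OF T]])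
  finally show "subcover_number Y (refined_cover Y (shift G) \<U> F) \<le> card (patterns G \<eta> (\<Union>s\<in>S. s <# F))"
    by (simp add: T_def)
qed

lemma minimal_refined_subcover:
  assumes \<U>: "open_cover Y \<U>" and F: "finite F" "F \<subseteq> carrier G"
  obtains \<W> where "\<W> \<subseteq> refined_cover Y (shift G) \<U> F" "finite \<W>" "\<Union>\<W> = topspace Y"
    "card \<W> = subcover_number Y (refined_cover Y (shift G) \<U> F)" "0 < card \<W>"
proof -
  obtain S where S: "finite S" "S \<subseteq> carrier G"
    "\<And>x. x \<in> X \<Longrightarrow> \<exists>U\<in>\<U>. \<forall>y\<in>X. (\<forall>s\<in>S. y s = x s) \<longrightarrow> y \<in> U"
    by (rule open_cover_window[OF \<U>]) (rule that)
  obtain \<V> where "\<V> \<subseteq> refined_cover Y (shift G) \<U> F" "finite \<V>" "\<Union>\<V> = topspace Y"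
    using refined_cover_patterns(1)[OF S F] by blast
  then obtain \<W> where \<W>: "\<W> \<subseteq> refined_cover Y (shift G) \<U> F" "finite \<W>" "\<Union>\<W> = topspace Y"
    "card \<W> = subcover_number Y (refined_cover Y (shift G) \<U> F)" by (rule minimal_subcover)
  moreover have "0 < card \<W>"
    using \<W>(2,3) X_nonempty topspace_Y by (auto simp: card_gt_0_iff)
  ultimately show thesis by (rule that)
qed

lemma subcover_number_refined_pos:
  assumes "open_cover Y \<U>" "finite F" "F \<subseteq> carrier G"
  shows "0 < subcover_number Y (refined_cover Y (shift G) \<U> F)"
  by (rule minimal_refined_subcover[OF assms]) simp

text \<open>Intersecting a cover for \<open>S\<close> with one for \<open>T\<close> gives a cover for \<open>S \<union> T\<close>, and a cover for \<open>S c\<close> is the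
  preimage under \<open>c\<close> of one for \<open>S\<close>.\<close>

lemma subadditive_subcover_number:
  assumes \<U>: "open_cover Y \<U>"
  shows "subadditive_set_function G (\<lambda>F. ln (real (subcover_number Y (refined_cover Y (shift G) \<U> F))))"
proof -
  define N where "N F = subcover_number Y (refined_cover Y (shift G) \<U> F)" for F
  have pos: "1 \<le> N F" if "finite F" "F \<subseteq> carrier G" for F
    using subcover_number_refined_pos[OF \<U> that] by (simp add: N_def)
  have "N {} \<le> 1"
  proof -
    have "N {} \<le> card {topspace Y}"
      unfolding N_def by (rule subcover_number_le) (auto simp: refined_cover_def)
    then show ?thesis by simp
  qed
  have sub: "N (S \<union> T) \<le> N S * N T" if S: "finite S" "S \<subseteq> carrier G" and T: "finite T" "T \<subseteq> carrier G" for S T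
  proof -
    obtain \<V> where \<V>: "\<V> \<subseteq> refined_cover Y (shift G) \<U> S" "finite \<V>" "\<Union>\<V> = topspace Y" "card \<V> = N S"
      using minimal_refined_subcover[OF \<U> S] unfolding N_def by metis
    obtain \<W> where \<W>: "\<W> \<subseteq> refined_cover Y (shift G) \<U> T" "finite \<W>" "\<Union>\<W> = topspace Y" "card \<W> = N T"
      using minimal_refined_subcover[OF \<U> T] unfolding N_def by metis
    have "N (S \<union> T) \<le> card ((\<lambda>(V, W). V \<inter> W) ` (\<V> \<times> \<W>))"
      unfolding N_def
    proof (rule subcover_number_le)
      show "\<Union>((\<lambda>(V, W). V \<inter> W) ` (\<V> \<times> \<W>)) = topspace Y" using \<V>(3) \<W>(3) by blast
      show "U \<subseteq> topspace Y" if "U \<in> refined_cover Y (shift G) \<U> (S \<union> T)" for U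
        using that by (rule refined_cover_subset)
      fix C assume "C \<in> (\<lambda>(V, W). V \<inter> W) ` (\<V> \<times> \<W>)"
      then obtain V W where VW: "V \<in> \<V>" "W \<in> \<W>" "C = V \<inter> W" by auto
      obtain v where v: "v \<in> S \<rightarrow> \<U>" "V = {y \<in> topspace Y. \<forall>f\<in>S. shift G f y \<in> v f}"
        using VW(1) \<V>(1) unfolding refined_cover_def by blast
      obtain w where w: "w \<in> T \<rightarrow> \<U>" "W = {y \<in> topspace Y. \<forall>f\<in>T. shift G f y \<in> w f}"
        using VW(2) \<W>(1) unfolding refined_cover_def by blast
      define u where "u f = (if f \<in> S then v f else w f)" for f
      have "u \<in> S \<union> T \<rightarrow> \<U>" using v w by (auto simp: u_def)
      moreover have "C \<subseteq> {y \<in> topspace Y. \<forall>f\<in>S\<union>T. shift G f y \<in> u f}" using VW v w by (auto simp: u_def)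
      ultimately show "\<exists>U\<in>refined_cover Y (shift G) \<U> (S \<union> T). C \<subseteq> U" unfolding refined_cover_def by blast
    qed (use \<V> \<W> in auto)
    also have "\<dots> \<le> card (\<V> \<times> \<W>)" using \<V> \<W> by (intro card_image_le) auto
    also have "\<dots> = N S * N T" using \<V> \<W> by (simp add: card_cartesian_product)
    finally show ?thesis .
  qed
  have inv: "N (S #> c) \<le> N S" if S: "finite S" "S \<subseteq> carrier G" and c: "c \<in> carrier G" for S c
  proof -
    obtain \<V> where \<V>: "\<V> \<subseteq> refined_cover Y (shift G) \<U> S" "finite \<V>" "\<Union>\<V> = topspace Y" "card \<V> = N S"
      using minimal_refined_subcover[OF \<U> S] unfolding N_def by metis
    define pull where "pull V = {y \<in> X. shift G c y \<in> V}" for V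
    have "N (S #> c) \<le> card (pull ` \<V>)"
      unfolding N_def
    proof (rule subcover_number_le)
      show "\<Union>(pull ` \<V>) = topspace Y"
      proof -
        have "\<exists>V\<in>\<V>. y \<in> pull V" if "y \<in> X" for y
          using shift_X[OF c that] \<V>(3) that topspace_Y by (auto simp: pull_def)
        then show ?thesis unfolding topspace_Y by (auto simp: pull_def)
      qed
      show "U \<subseteq> topspace Y" if "U \<in> refined_cover Y (shift G) \<U> (S #> c)" for U
        using that by (rule refined_cover_subset)
      fix C assume "C \<in> pull ` \<V>"
      then obtain V where V: "V \<in> \<V>" "C = pull V" by auto
      obtain v where v: "v \<in> S \<rightarrow> \<U>" "V = {y \<in> topspace Y. \<forall>f\<in>S. shift G f y \<in> v f}"
        using V(1) \<V>(1) unfolding refined_cover_def by blast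
      define u where "u f = v (f \<otimes> inv c)" for f
      have cancel_c: "s \<otimes> c \<otimes> inv c = s" if "s \<in> S" for s using that S c by (auto simp: m_assoc)
      have "u \<in> (S #> c) \<rightarrow> \<U>" using v(1) by (auto simp: u_def r_coset_def cancel_c)
      moreover have "C \<subseteq> {y \<in> topspace Y. \<forall>f\<in>S #> c. shift G f y \<in> u f}"
      proof (intro subsetI CollectI conjI ballI)
        fix y f assume y: "y \<in> C" and f: "f \<in> S #> c"
        then obtain s where s: "s \<in> S" "f = s \<otimes> c" by (auto simp: r_coset_def)
        have "shift G f y = shift G s (shift G c y)"
          using s S c by (auto simp: shift_def fun_eq_iff m_assoc)
        then show "shift G f y \<in> u f" using y s v V by (simp add: u_def cancel_c pull_def)
      qed (use V topspace_Y in \<open>auto simp: pull_def\<close>)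
      ultimately show "\<exists>U\<in>refined_cover Y (shift G) \<U> (S #> c). C \<subseteq> U" unfolding refined_cover_def by blast
    qed (use \<V> in auto)
    also have "\<dots> \<le> N S" using \<V> card_image_le by metis
    finally show ?thesis .
  qed
  have "subadditive_set_function G (\<lambda>F. ln (real (N F)))"
  proof (unfold_locales)
    fix S assume S: "finite S" "S \<subseteq> carrier G"
    show "0 \<le> ln (real (N S))" using pos[OF S] by simp
    show "ln (real (N (S #> c))) \<le> ln (real (N S))" if c: "c \<in> carrier G" for c
    proof -
      have "1 \<le> N (S #> c)" using S c by (intro pos finite_r_coset r_coset_subset_G)
      then show ?thesis using inv[OF S c] by simp
    qed
    show "ln (real (N (S \<union> T))) \<le> ln (real (N S)) + ln (real (N T))" if T: "finite T" "T \<subseteq> carrier G" for T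
    proof -
      have "1 \<le> N (S \<union> T)" using S T by (intro pos) auto
      then have "ln (real (N (S \<union> T))) \<le> ln (real (N S * N T))"
        using sub[OF S T] pos[OF S] pos[OF T] by (subst ln_le_cancel_iff) (auto simp flip: of_nat_mult)
      also have "\<dots> = ln (real (N S)) + ln (real (N T))" using pos[OF S] pos[OF T] by (simp add: ln_mult)
      finally show ?thesis .
    qed
  next
    show "ln (real (N {})) = 0" using \<open>N {} \<le> 1\<close> pos[of "{}"] by (simp add: order_antisym)
  qed
  then show ?thesis by (simp add: N_def)
qed

lemma cover_entropy_limit:
  assumes \<U>: "open_cover Y \<U>" and F: "folner_sequence G F"
  shows "(\<lambda>n. ln (real (subcover_number Y (refined_cover Y (shift G) \<U> (F n)))) / real (card (F n)))
    \<longlonglongrightarrow> cover_entropy G Y (shift G) \<U>"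
proof -
  interpret subadditive_set_function G "\<lambda>F. ln (real (subcover_number Y (refined_cover Y (shift G) \<U> F)))"
    by (rule subadditive_subcover_number[OF \<U>])
  obtain L where L: "\<forall>F. folner_sequence G F \<longrightarrow>
     (\<lambda>n. ln (real (subcover_number Y (refined_cover Y (shift G) \<U> (F n)))) / real (card (F n))) \<longlonglongrightarrow> L"
    using ornstein_weiss[OF F] by blast
  have "cover_entropy G Y (shift G) \<U> = L"
    unfolding cover_entropy_def
  proof (rule the_equality)
    fix L' assume L': "\<forall>F. folner_sequence G F \<longrightarrow>
     (\<lambda>n. ln (real (subcover_number Y (refined_cover Y (shift G) \<U> (F n)))) / real (card (F n))) \<longlonglongrightarrow> L'"
    show "L' = L" by (rule LIMSEQ_unique[OF L'[rule_format, OF F] L[rule_format, OF F]])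
  qed (rule L)
  then show ?thesis using L F by simp
qed

definition symbol_cover :: "('g \<Rightarrow> 'a) set set" where
  "symbol_cover = (\<lambda>a. {x \<in> X. x \<one> = a}) ` A"

lemma open_cover_symbol_cover: "open_cover Y symbol_cover"
  unfolding open_cover_def topspace_Y
proof
  show "\<Union>symbol_cover = X" using X_subset by (fastforce simp: symbol_cover_def configurations_def)
  show "\<forall>U\<in>symbol_cover. openin Y U"
  proof
    fix U assume "U \<in> symbol_cover"
    then obtain a where "U = {x \<in> X. x \<one> = a}" by (auto simp: symbol_cover_def)
    then have "U = {x \<in> configurations G A. \<forall>s\<in>{\<one>}. x s = a} \<inter> X" using X_subset by auto
    then show "openin Y U" using openin_cylinder[of "{\<one>}" "\<lambda>_. a"] by (simp add: openin_subtopology_Int)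
  qed
qed

text \<open>The symbol cover is a partition, so a member of its refinement over \<open>F\<close> consists of points with
  one and the same pattern on \<open>F\<close>, and no member of the refinement can be spared.\<close>

lemma patterns_le_symbol_cover:
  assumes F: "finite F" "F \<subseteq> carrier G"
  shows "card (patterns G \<eta> F) \<le> subcover_number Y (refined_cover Y (shift G) symbol_cover F)"
proof -
  obtain \<W> where \<W>: "\<W> \<subseteq> refined_cover Y (shift G) symbol_cover F" "finite \<W>" "\<Union>\<W> = topspace Y"
    "card \<W> = subcover_number Y (refined_cover Y (shift G) symbol_cover F)"
    using minimal_refined_subcover[OF open_cover_symbol_cover F] by metis
  have "\<exists>W\<in>\<W>. \<exists>y\<in>W. restrict y F = p" if p: "p \<in> patterns G \<eta> F" for p
  proof -
    obtain \<gamma> where \<gamma>: "\<gamma> \<in> carrier G" "p = (\<lambda>s\<in>F. \<eta> (s \<otimes> \<gamma>))" using p by (auto simp: patterns_def)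
    then obtain W where "W \<in> \<W>" "shift G \<gamma> \<eta> \<in> W"
      using shift_orbit_in_X[OF \<gamma>(1)] \<W>(3) topspace_Y by blast
    moreover have "restrict (shift G \<gamma> \<eta>) F = p" using \<gamma>(2) F(2) by (auto simp: shift_def fun_eq_iff)
    ultimately show ?thesis by blast
  qed
  then obtain W where W: "\<And>p. p \<in> patterns G \<eta> F \<Longrightarrow> W p \<in> \<W> \<and> (\<exists>y\<in>W p. restrict y F = p)" by metis
  have const: "restrict y F = restrict z F" if V: "V \<in> \<W>" and yz: "y \<in> V" "z \<in> V" for V y z
  proof -
    obtain w where w: "w \<in> F \<rightarrow> symbol_cover" "V = {y \<in> topspace Y. \<forall>f\<in>F. shift G f y \<in> w f}"
      using V \<W>(1) unfolding refined_cover_def by blast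
    have "y f = z f" if f: "f \<in> F" for f
    proof -
      obtain a where a: "w f = {x \<in> X. x \<one> = a}" using w(1) f by (auto simp: symbol_cover_def)
      have "shift G f y \<in> w f" "shift G f z \<in> w f" using w(2) yz f by auto
      then show ?thesis using a f F by (auto simp: shift_def)
    qed
    then show ?thesis by (auto simp: restrict_def)
  qed
  have "inj_on W (patterns G \<eta> F)"
  proof (rule inj_onI)
    fix p q assume "p \<in> patterns G \<eta> F" "q \<in> patterns G \<eta> F" "W p = W q"
    then show "p = q" using W[of p] W[of q] const by metis
  qed
  then have "card (patterns G \<eta> F) \<le> card \<W>"
    by (rule card_inj_on_le) (use W \<W>(2) in auto)
  with \<W>(4) show ?thesis by simp
qed

end

section \<open>Counting patterns\<close>

text \<open>A pattern is determined by the coset of its position modulo \<open>H k\<close> and by its symbols on the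
  holes: for positions in the same coset, normality of \<open>H k\<close> makes the holes occur at the same
  places of \<open>S\<close>, and the symbols elsewhere agree by periodicity.\<close>

lemma (in residual_chain) card_patterns_le:
  fixes A :: "'a set"
  assumes A: "finite A" and x: "x \<in> configurations G A"
    and S: "finite S" "S \<subseteq> carrier G" and Q: "left_invariant_under G (H k) Q"
    and inv: "\<And>\<gamma> g. \<gamma> \<in> H k \<Longrightarrow> g \<in> carrier G - Q \<Longrightarrow> x (\<gamma> \<otimes> g) = x g"
    and b: "\<And>C. C \<in> rcosets (H k) \<Longrightarrow> \<exists>a\<in>C. card {s \<in> S. s \<otimes> a \<in> Q} \<le> b"
  shows "card (patterns G x S) \<le> card (rcosets (H k)) * card A ^ b"
proof -
  have A_pos: "1 \<le> card A"
  proof -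
    have "x \<one> \<in> A" using x by (auto simp: configurations_def)
    then show ?thesis using A by (auto simp: Suc_le_eq card_gt_0_iff)
  qed
  define pat where "pat \<gamma> = (\<lambda>s\<in>S. x (s \<otimes> \<gamma>))" for \<gamma>
  have move: "s \<otimes> \<gamma> = (s \<otimes> h \<otimes> inv s) \<otimes> (s \<otimes> a)" "s \<otimes> h \<otimes> inv s \<in> H k" "inv (s \<otimes> h \<otimes> inv s) \<in> H k"
    if "s \<in> S" "h \<in> H k" "a \<in> carrier G" "\<gamma> = h \<otimes> a" for s h a \<gamma>
  proof -
    have G: "s \<in> carrier G" "h \<in> carrier G" using that S H_subset by auto
    have "inv s \<otimes> (s \<otimes> a) = a" using G that(3) by (simp add: m_assoc[symmetric])
    then show "s \<otimes> \<gamma> = (s \<otimes> h \<otimes> inv s) \<otimes> (s \<otimes> a)" using G that(3,4) by (simp add: m_assoc)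
    show "s \<otimes> h \<otimes> inv s \<in> H k" using normal.inv_op_closed2[OF normal G(1) that(2)] .
    then show "inv (s \<otimes> h \<otimes> inv s) \<in> H k" using subgroup_H by (simp add: subgroup.m_inv_closed)
  qed
  have coset: "card (pat ` C) \<le> card A ^ b" if C: "C \<in> rcosets (H k)" for C
  proof -
    obtain a where a: "a \<in> C" "card {s \<in> S. s \<otimes> a \<in> Q} \<le> b" using b[OF C] by blast
    have CG: "C \<subseteq> carrier G" using C rcosets_part_G[OF subgroup_H, of k] by blast
    have aG: "a \<in> carrier G" using a CG by auto
    have C_eq: "C = H k #> a"
      using rcosets_eq_if_meet[OF subgroup_H C _ a(1) rcos_self[OF aG subgroup_H]] aG H_subset
      by (simp add: rcosetsI)
    define B where "B = {s \<in> S. s \<otimes> a \<in> Q}"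
    have finB: "finite B" using S by (simp add: B_def)
    have off: "x (s \<otimes> \<gamma>) = x (s \<otimes> a)" if s: "s \<in> S" "s \<notin> B" and \<gamma>: "\<gamma> \<in> C" for s \<gamma>
    proof -
      obtain h where h: "h \<in> H k" "\<gamma> = h \<otimes> a" using \<gamma> C_eq by (auto simp: r_coset_def)
      have "s \<otimes> a \<in> carrier G - Q" using s aG S by (auto simp: B_def)
      then show ?thesis using inv move[OF s(1) h(1) aG h(2)] by metis
    qed
    have "inj_on (\<lambda>p. restrict p B) (pat ` C)"
    proof (rule inj_onI)
      fix p q assume pq: "p \<in> pat ` C" "q \<in> pat ` C" and eq: "restrict p B = restrict q B"
      then obtain \<gamma> \<delta> where \<gamma>: "\<gamma> \<in> C" "p = pat \<gamma>" and \<delta>: "\<delta> \<in> C" "q = pat \<delta>" by blast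
      have "p s = q s" for s
      proof (cases "s \<in> B")
        case True
        then show ?thesis using fun_cong[OF eq, of s] by simp
      next
        case False
        then show ?thesis using off[of s] \<gamma> \<delta> by (cases "s \<in> S") (auto simp: pat_def)
      qed
      then show "p = q" by auto
    qed
    moreover have "(\<lambda>p. restrict p B) ` pat ` C \<subseteq> B \<rightarrow>\<^sub>E A"
      using x CG S by (auto simp: pat_def configurations_def B_def PiE_iff subset_iff)
    ultimately have "card (pat ` C) \<le> card (B \<rightarrow>\<^sub>E A)"
      using finB A by (intro card_inj_on_le finite_PiE) auto
    also have "\<dots> = card A ^ card B" using finB by (simp add: card_PiE)
    also have "\<dots> \<le> card A ^ b" using a(2) A_pos by (intro power_increasing) (auto simp: B_def)
    finally show ?thesis .
  qed
  have "patterns G x S = (\<Union>C\<in>rcosets (H k). pat ` C)"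
    unfolding patterns_def pat_def[symmetric] using rcosets_part_G[OF subgroup_H, of k] by auto
  then have "card (patterns G x S) \<le> (\<Sum>C\<in>rcosets (H k). card (pat ` C))"
    using card_UN_le[OF finite_index] by simp
  also have "\<dots> \<le> (\<Sum>C\<in>rcosets (H k). card A ^ b)" using coset by (rule sum_mono)
  finally show ?thesis by simp
qed

text \<open>Among the elements of \<open>K F\<close>, those of \<open>F\<close> meet the holes in at most the proportion \<open>\<delta>\<close>, uniformly
  over the finitely many cosets of positions; the others are negligible, and so is the logarithm of
  the number of cosets.\<close>

lemma (in residual_chain) pattern_growth_le:
  fixes A :: "'a set"
  assumes A: "finite A" "card A \<noteq> 0" and x: "x \<in> configurations G A"
    and K: "finite K" "K \<subseteq> carrier G" and F: "folner_sequence G F"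
    and Q: "left_invariant_under G (H k) Q" and \<delta>: "coset_density G (H k) Q < \<delta>"
    and inv: "\<And>\<gamma> g. \<gamma> \<in> H k \<Longrightarrow> g \<in> carrier G - Q \<Longrightarrow> x (\<gamma> \<otimes> g) = x g"
    and lim: "l \<longlonglongrightarrow> L"
    and l: "\<And>n. l n \<le> ln (real (card (patterns G x (\<Union>s\<in>K. s <# F n)))) / card (F n)"
  shows "L \<le> \<delta> * ln (card A)"
proof -
  define T where "T n = (\<Union>s\<in>K. s <# F n)" for n
  define I where "I = card (rcosets (H k))"
  have ln_A: "0 \<le> ln (real (card A))" using A(2) by (intro ln_ge_zero) simp
  have \<delta>0: "0 \<le> \<delta>"
  proof -
    have "0 \<le> coset_density G (H k) Q" by (simp add: coset_density_def)
    with \<delta> show ?thesis by simp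
  qed
  have T: "finite (T n)" "T n \<subseteq> carrier G" for n
    using K folner_sequenceD[OF F, of n] by (auto simp: T_def finite_l_coset l_coset_def)
  have I: "1 \<le> I" 
    using finite_index rcosets_part_G[OF subgroup_H, of k] by (auto simp: I_def Suc_le_eq card_gt_0_iff)
  define u where "u n = ln (real I) / card (F n) + (\<delta> + card (T n - F n) / card (F n)) * ln (card A)" for n
  have "u \<longlonglongrightarrow> 0 + (\<delta> + 0) * ln (card A)"
    unfolding u_def T_def
    by (intro tendsto_intros folner_expansion[OF F K] real_tendsto_divide_at_top[OF tendsto_const] folner_card_at_top[OF F])
  then have u: "u \<longlonglongrightarrow> \<delta> * ln (card A)" by simp
  have "\<forall>\<^sub>F n in sequentially. \<forall>C\<in>rcosets (H k). \<exists>a\<in>C. card {s \<in> F n. s \<otimes> a \<in> Q} < \<delta> * card (F n)"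
  proof (intro eventually_ball_finite finite_index ballI)
    fix C assume C: "C \<in> rcosets (H k)"
    then obtain a where a: "a \<in> carrier G" "C = H k #> a" by (auto simp: RCOSETS_def)
    then have aC: "a \<in> C" using rcos_self[OF a(1) subgroup_H] by simp
    have Fa: "folner_sequence G (\<lambda>n. F n #> a)" by (rule folner_sequence_r_coset[OF F a(1)])
    have "\<forall>\<^sub>F n in sequentially. card ((F n #> a) \<inter> Q) / card (F n #> a) < \<delta>"
      using folner_density[OF Fa normal finite_index Q] \<delta> by (rule order_tendstoD)
    then show "\<forall>\<^sub>F n in sequentially. \<exists>a\<in>C. card {s \<in> F n. s \<otimes> a \<in> Q} < \<delta> * card (F n)"
    proof eventually_elim
      case (elim n)
      note Fn = folner_sequenceD[OF F, of n]
      have "(F n #> a) \<inter> Q = {s \<in> F n. s \<otimes> a \<in> Q} #> a" by (auto simp: r_coset_def)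
      moreover have "card ({s \<in> F n. s \<otimes> a \<in> Q} #> a) = card {s \<in> F n. s \<otimes> a \<in> Q}"
        using Fn a by (intro card_r_coset) auto
      ultimately have "card {s \<in> F n. s \<otimes> a \<in> Q} < \<delta> * card (F n)"
        using elim Fn card_r_coset[OF Fn(3) a(1)] by (simp add: pos_divide_less_eq)
      then show ?case using aC by blast
    qed
  qed
  then have "\<forall>\<^sub>F n in sequentially. l n \<le> u n"
  proof eventually_elim
    case (elim n)
    note Fn = folner_sequenceD[OF F, of n]
    define b where "b = nat \<lfloor>\<delta> * card (F n)\<rfloor> + card (T n - F n)"
    have "\<exists>a\<in>C. card {s \<in> T n. s \<otimes> a \<in> Q} \<le> b" if C: "C \<in> rcosets (H k)" for C
    proof -
      obtain a where a: "a \<in> C" "card {s \<in> F n. s \<otimes> a \<in> Q} < \<delta> * card (F n)" using elim C by blast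
      have "card {s \<in> T n. s \<otimes> a \<in> Q} \<le> card ({s \<in> F n. s \<otimes> a \<in> Q} \<union> (T n - F n))"
        using Fn T by (intro card_mono) auto
      also have "\<dots> \<le> card {s \<in> F n. s \<otimes> a \<in> Q} + card (T n - F n)" by (rule card_Un_le)
      also have "card {s \<in> F n. s \<otimes> a \<in> Q} \<le> nat \<lfloor>\<delta> * card (F n)\<rfloor>"
        using a(2) by (simp add: le_nat_floor)
      finally show ?thesis using a(1) by (auto simp: b_def)
    qed
    then have "card (patterns G x (T n)) \<le> I * card A ^ b"
      unfolding I_def by (intro card_patterns_le[OF A(1) x T Q inv]) auto
    moreover have "patterns G x (T n) \<noteq> {}" "finite (patterns G x (T n))"
    proof -
      show "patterns G x (T n) \<noteq> {}" by (auto simp: patterns_def)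
      have "patterns G x (T n) \<subseteq> T n \<rightarrow>\<^sub>E A"
        using x T(2)[of n] by (auto simp: patterns_def configurations_def PiE_iff subset_iff)
      then show "finite (patterns G x (T n))" by (rule finite_subset) (intro finite_PiE T A(1))
    qed
    ultimately have "ln (real (card (patterns G x (T n)))) \<le> ln (real (I * card A ^ b))"
      using I A by (subst ln_le_cancel_iff) (auto simp: card_gt_0_iff simp flip: of_nat_mult of_nat_power)
    also have "\<dots> = ln (real I) + b * ln (card A)"
      using I A by (simp add: ln_mult ln_realpow)
    also have "\<dots> \<le> ln (real I) + (\<delta> * card (F n) + card (T n - F n)) * ln (card A)"
      using ln_A \<delta>0 by (intro add_left_mono mult_right_mono) (auto simp: b_def)
    finally have "ln (real (card (patterns G x (T n)))) / card (F n)
        \<le> (ln (real I) + (\<delta> * card (F n) + card (T n - F n)) * ln (card A)) / card (F n)"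
      by (rule divide_right_mono) simp
    also have "\<dots> = u n" using Fn(4) by (simp add: u_def field_simps)
    finally show ?case using l[of n] by (simp add: T_def)
  qed
  then show ?thesis using lim u by (intro tendsto_le[OF _ u lim]) auto
qed

section \<open>Toeplitz configurations of prescribed entropy\<close>

theorem theorem57:
  fixes G :: "('g, 'm) monoid_scheme" and A :: "'a set" and h :: real
  assumes "group G"
    and "countable (carrier G)" and "infinite (carrier G)"
    and "amenable G" and "residually_finite G"
    and "finite A"
    and "0 \<le> h" and "h < ln (real (card A))"
  shows "\<exists>\<eta>. toeplitz G A \<eta> \<and> configuration_entropy G A \<eta> = ereal h"
proof -
  obtain F where F: "folner_sequence G F" using assms(4) by (auto simp: amenable_def)
  obtain H where H: "\<And>n. H n \<lhd> G" "\<And>n. finite (rcosets\<^bsub>G\<^esub> (H n))" "\<And>n. H (Suc n) \<subseteq> H n"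
      "(\<Inter>n. H n) = {\<one>\<^bsub>G\<^esub>}"
    using assms(5) unfolding residually_finite_def by blast
  have ln_A: "0 < ln (real (card A))" using assms(7,8) by linarith
  then have A: "card A \<noteq> 0" by (intro notI) simp
  define d where "d = h / ln (real (card A))"
  have d: "0 \<le> d" "d < 1" and h: "h = d * ln (real (card A))"
    using assms(7,8) ln_A by (auto simp: d_def)
  interpret residual_chain G H
    by (intro residual_chain.intro residual_chain_axioms.intro assms(1,3) H)
  interpret toeplitz_construction G H F A d
    by unfold_locales (use assms(6) F A d in auto)
  obtain \<eta> where toep: "toeplitz G A \<eta>"
    and holes: "\<And>e. 0 < e \<Longrightarrow> \<exists>k Q. left_invariant_under G (H k) Q \<and> coset_density G (H k) Q < d + e \<and>
       (\<forall>\<gamma>\<in>H k. \<forall>g\<in>carrier G - Q. \<eta> (\<gamma> \<otimes>\<^bsub>G\<^esub> g) = \<eta> g)"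
    and free: "\<And>n. \<exists>m\<ge>n. \<exists>B\<subseteq>F m. d * card (F m) \<le> card B \<and>
       (\<forall>y\<in>B \<rightarrow>\<^sub>E A. \<exists>\<gamma>\<in>carrier G. \<forall>b\<in>B. \<eta> (b \<otimes>\<^bsub>G\<^esub> \<gamma>) = y b)"
    by (rule toeplitz_with_hole_density[OF d(2) assms(2)]) (rule that)
  have conf: "\<eta> \<in> configurations G A" using toep by (simp add: toeplitz_def)
  interpret orbit_system G A \<eta> by unfold_locales (use conf assms(6) in auto)
  have upper: "cover_entropy G Y (shift G) \<U> \<le> h" if \<U>: "open_cover Y \<U>" for \<U>
  proof -
    obtain S where S: "finite S" "S \<subseteq> carrier G"
      and window: "\<And>x. x \<in> X \<Longrightarrow> \<exists>U\<in>\<U>. \<forall>y\<in>X. (\<forall>s\<in>S. y s = x s) \<longrightarrow> y \<in> U"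
      by (rule open_cover_window[OF \<U>]) (rule that)
    define l where "l n = ln (real (subcover_number Y (refined_cover Y (shift G) \<U> (F n)))) / card (F n)" for n
    have l: "l n \<le> ln (real (card (patterns G \<eta> (\<Union>s\<in>S. s <#\<^bsub>G\<^esub> F n)))) / card (F n)" for n
    proof -
      note Fn = folner_sequenceD[OF F, of n]
      have "0 < subcover_number Y (refined_cover Y (shift G) \<U> (F n))"
        by (rule subcover_number_refined_pos[OF \<U> Fn(1,3)])
      then show ?thesis
        unfolding l_def using refined_cover_patterns(2)[OF S window Fn(1,3)]
        by (intro divide_right_mono) auto
    qed
    have lim: "l \<longlonglongrightarrow> cover_entropy G Y (shift G) \<U>"
      unfolding l_def by (rule cover_entropy_limit[OF \<U> F])
    have "cover_entropy G Y (shift G) \<U> \<le> (d + e) * ln (card A)" if e: "0 < e" for e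
    proof -
      obtain k Q where kQ: "left_invariant_under G (H k) Q" "coset_density G (H k) Q < d + e"
        "\<And>\<gamma> g. \<gamma> \<in> H k \<Longrightarrow> g \<in> carrier G - Q \<Longrightarrow> \<eta> (\<gamma> \<otimes>\<^bsub>G\<^esub> g) = \<eta> g"
        using holes[OF e] by blast
      show ?thesis by (rule pattern_growth_le[OF assms(6) A conf S F kQ lim l])
    qed
    then have "cover_entropy G Y (shift G) \<U> / ln (card A) \<le> d + e" if "0 < e" for e
      using that ln_A by (simp add: pos_divide_le_eq)
    then have "cover_entropy G Y (shift G) \<U> / ln (card A) \<le> d" by (rule field_le_epsilon)
    then show ?thesis using ln_A by (simp add: pos_divide_le_eq h)
  qed
  \<comment> \<open>It suffices to find infinitely many Folner sets with enough patterns, because the limit exists.\<close>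
  have lower: "h \<le> cover_entropy G Y (shift G) symbol_cover"
  proof (rule ccontr)
    assume "\<not> ?thesis"
    then have "\<forall>\<^sub>F n in sequentially. 
      ln (real (subcover_number Y (refined_cover Y (shift G) symbol_cover (F n)))) / card (F n) < h"
      by (intro order_tendstoD(2)[OF cover_entropy_limit[OF open_cover_symbol_cover F]]) simp
    then obtain n where n: "\<And>m. n \<le> m \<Longrightarrow>
      ln (real (subcover_number Y (refined_cover Y (shift G) symbol_cover (F m)))) / card (F m) < h"
      by (auto simp: eventually_sequentially)
    obtain m B where m: "n \<le> m" and B: "B \<subseteq> F m" "d * card (F m) \<le> card B"
      and y: "\<forall>y\<in>B \<rightarrow>\<^sub>E A. \<exists>\<gamma>\<in>carrier G. \<forall>b\<in>B. \<eta> (b \<otimes>\<^bsub>G\<^esub> \<gamma>) = y b"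
      using free[of n] by (elim exE conjE)
    note Fm = folner_sequenceD[OF F, of m]
    have finB: "finite B" by (rule finite_subset[OF B(1) Fm(1)])
    have "B \<rightarrow>\<^sub>E A \<subseteq> (\<lambda>p. restrict p B) ` patterns G \<eta> (F m)"
    proof
      fix z assume z: "z \<in> B \<rightarrow>\<^sub>E A"
      then obtain \<gamma> where \<gamma>: "\<gamma> \<in> carrier G" "\<forall>b\<in>B. \<eta> (b \<otimes>\<^bsub>G\<^esub> \<gamma>) = z b" using bspec[OF y z] by (elim bexE)
      have "restrict (\<lambda>s\<in>F m. \<eta> (s \<otimes>\<^bsub>G\<^esub> \<gamma>)) B = z"
        using \<gamma>(2) z B(1) by (auto simp: fun_eq_iff PiE_iff extensional_def)
      then show "z \<in> (\<lambda>p. restrict p B) ` patterns G \<eta> (F m)" using \<gamma>(1) unfolding patterns_def by blast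
    qed
    then have "card (B \<rightarrow>\<^sub>E A) \<le> card (patterns G \<eta> (F m))"
      by (rule surj_card_le[OF finite_patterns[OF Fm(1,3)]])
    also have "\<dots> \<le> subcover_number Y (refined_cover Y (shift G) symbol_cover (F m))"
      by (rule patterns_le_symbol_cover[OF Fm(1,3)])
    finally have "card A ^ card B \<le> subcover_number Y (refined_cover Y (shift G) symbol_cover (F m))"
      using finB by (simp add: card_PiE)
    then have "ln (real (card A ^ card B)) \<le> ln (real (subcover_number Y (refined_cover Y (shift G) symbol_cover (F m))))"
      using A by (intro ln_mono) (simp_all only: of_nat_le_iff, simp)
    moreover have "h * card (F m) \<le> ln (real (card A ^ card B))"
      using mult_right_mono[OF B(2), of "ln (card A)"] ln_A A by (simp add: h ln_realpow mult_ac)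
    moreover have "ln (real (subcover_number Y (refined_cover Y (shift G) symbol_cover (F m)))) < h * card (F m)"
      using n[OF m] Fm(4) by (simp add: pos_divide_less_eq)
    ultimately show False by linarith
  qed
  have "topological_entropy G Y (shift G) = ereal h"
    unfolding topological_entropy_def
  proof (rule antisym)
    show "(SUP \<U>\<in>{\<U>. open_cover Y \<U>}. ereal (cover_entropy G Y (shift G) \<U>)) \<le> ereal h"
      by (rule SUP_least) (simp add: upper)
    have "ereal h \<le> ereal (cover_entropy G Y (shift G) symbol_cover)" using lower by simp
    also have "\<dots> \<le> (SUP \<U>\<in>{\<U>. open_cover Y \<U>}. ereal (cover_entropy G Y (shift G) \<U>))"
      by (rule SUP_upper) (simp add: open_cover_symbol_cover)
    finally show "ereal h \<le> (SUP \<U>\<in>{\<U>. open_cover Y \<U>}. ereal (cover_entropy G Y (shift G) \<U>))" .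
  qed
  then have "configuration_entropy G A \<eta> = ereal h" by (simp add: configuration_entropy_def)
  with toep show ?thesis by blast
qed

end
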